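(* For $\lambda\in kG$, no simple $H_\lambda$-module has a projective cover.
   Context: Let $p$ be an odd prime, $k$ an algebraically closed field of characteristic $p$, and $G=\langle g\rangle$ the cyclic group of order $p$ generated by $g=\begin{pmatrix}1&1\\0&1\end{pmatrix}\in \mathrm{SL}(2,p)$. $G$ acts on the free algebra $k\langle x,y\rangle$ by algebra automorphisms with $g\cdot x=x$, $g\cdot y=x+y$, and $k\langle x,y\rangle\rtimes G$ is the smash product (so $gf=(g\cdot f)g$). For $\lambda\in kG$ set $H_\lambda=(k\langle x,y\rangle\rtimes G)/(xy-yx-\lambda)$. Modules are left modules. *)

theory Defs
  imports
    "HOL-Analysis.Analysis"
    "HOL-Library.Poly_Mapping"
    "HOL-Algebra.QuotRing"
    "HOL-Algebra.Module"
    "HOL-Algebra.Generated_Groups"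
begin

section \<open>Free algebras\<close>

text \<open>The free algebra on the letters \<open>'v\<close> is the monoid algebra of the free monoid on \<open>'v\<close>.
  Finitely supported functions multiply by convolution with respect to \<open>+\<close> on the index type,
  so the free monoid is written additively.\<close>

datatype 'v fmon = FMon (letters: "'v list")

instantiation fmon :: (type) monoid_add
begin

definition "0 = FMon []"

definition "u + v = FMon (letters u @ letters v)"

instance
  by standard (simp_all add: zero_fmon_def plus_fmon_def)

end

type_synonym ('v, 'k) free_alg = "'v fmon \<Rightarrow>\<^sub>0 'k"

definition scalar :: "'k::field \<Rightarrow> ('v, 'k) free_alg"
  where "scalar c = Poly_Mapping.single 0 c"

definition gen :: "'v \<Rightarrow> ('v, 'k::field) free_alg"
  where "gen v = Poly_Mapping.single (FMon [v]) 1"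

text \<open>The algebra homomorphism with \<open>gen v \<mapsto> \<phi> v\<close>.\<close>

definition free_alg_hom ::
    "('v \<Rightarrow> ('w, 'k::field) free_alg) \<Rightarrow> ('v, 'k) free_alg \<Rightarrow> ('w, 'k) free_alg"
  where "free_alg_hom \<phi> f =
    (\<Sum>u\<in>Poly_Mapping.keys f.
      scalar (Poly_Mapping.lookup f u) * prod_list (map \<phi> (letters u)))"

section \<open>The group and its action\<close>

text \<open>In a field of characteristic \<open>p\<close>, the image of the integers is the prime field with \<open>p\<close>
  elements; \<open>SL(2,p)\<close> is realised as the matrices over \<open>'k\<close> of determinant 1 with entries there.\<close>

definition SL2_prime :: "('k::field ^ 2 ^ 2) monoid"
  where "SL2_prime =
    \<lparr>carrier = {A. det A = 1 \<and> (\<forall>i j. A $ i $ j \<in> range of_int)}, mult = (**), one = mat 1\<rparr>"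

definition g_mat :: "'k::field ^ 2 ^ 2"
  where "g_mat = vector [vector [1, 1], vector [0, 1]]"

definition cyc_G :: "('k::field ^ 2 ^ 2) monoid"
  where "cyc_G = subgroup_generated SL2_prime {g_mat}"

text \<open>A matrix acts on the span of the generators with respect to the basis
  \<open>x = gen 1\<close>, \<open>y = gen 2\<close>, coordinates being columns.\<close>

definition mat_act :: "'k::field ^ 2 ^ 2 \<Rightarrow> (2, 'k) free_alg \<Rightarrow> (2, 'k) free_alg"
  where "mat_act A = free_alg_hom (\<lambda>j. \<Sum>i\<in>UNIV. scalar (A $ i $ j) * gen i)"

lemma free_alg_hom_gen: "free_alg_hom \<phi> (gen v) = \<phi> v"
  by (simp add: free_alg_hom_def gen_def scalar_def)

lemma mat_act_g_x: "mat_act g_mat (gen 1) = (gen 1 :: (2, 'k::field) free_alg)"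
  by (simp add: mat_act_def free_alg_hom_gen g_mat_def UNIV_2 vector_2 scalar_def)

lemma mat_act_g_y: "mat_act g_mat (gen 2) = (gen 1 + gen 2 :: (2, 'k::field) free_alg)"
  by (simp add: mat_act_def free_alg_hom_gen g_mat_def UNIV_2 vector_2 scalar_def)

section \<open>Smash products\<close>

text \<open>For a finite group \<open>G\<close> acting on a ring, the function \<open>f\<close> stands for the sum of \<open>f a \<cdot> a\<close>
  over \<open>a\<close> in \<open>G\<close>, and \<open>(r \<cdot> a) (s \<cdot> b) = r (act a s) \<cdot> (a b)\<close>. For infinite \<open>G\<close> one would have
  to demand finite support.\<close>

definition smash :: "('g, 'n) monoid_scheme \<Rightarrow> ('g \<Rightarrow> 'r \<Rightarrow> 'r) \<Rightarrow> ('g \<Rightarrow> 'r::ring_1) ring"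
  where "smash G act =
    \<lparr>carrier = {f. \<forall>a. a \<notin> carrier G \<longrightarrow> f a = 0},
     mult = (\<lambda>f h c. \<Sum>(a, b) | a \<in> carrier G \<and> b \<in> carrier G \<and> a \<otimes>\<^bsub>G\<^esub> b = c.
               f a * act a (h b)),
     one = (\<lambda>a. if a = \<one>\<^bsub>G\<^esub> then 1 else 0),
     zero = (\<lambda>_. 0),
     add = (\<lambda>f h a. f a + h a)\<rparr>"

definition smash_coeff :: "('g, 'n) monoid_scheme \<Rightarrow> 'r \<Rightarrow> 'g \<Rightarrow> 'r::ring_1"
  where "smash_coeff G r = (\<lambda>a. if a = \<one>\<^bsub>G\<^esub> then r else 0)"

section \<open>The algebras \<open>H\<^sub>\<lambda>\<close>\<close>

definition kG :: "('k::field ^ 2 ^ 2 \<Rightarrow> 'k) set"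
  where "kG = {lam. \<forall>a. a \<notin> carrier cyc_G \<longrightarrow> lam a = 0}"

definition H_smash :: "('k::field ^ 2 ^ 2 \<Rightarrow> (2, 'k) free_alg) ring"
  where "H_smash = smash cyc_G mat_act"

definition H_alg :: "('k::field ^ 2 ^ 2 \<Rightarrow> 'k) \<Rightarrow> ('k ^ 2 ^ 2 \<Rightarrow> (2, 'k) free_alg) set ring"
  where "H_alg lam =
    (let x = smash_coeff cyc_G (gen 1); y = smash_coeff cyc_G (gen 2)
     in H_smash Quot (Idl\<^bsub>H_smash\<^esub>
       {x \<otimes>\<^bsub>H_smash\<^esub> y \<ominus>\<^bsub>H_smash\<^esub> y \<otimes>\<^bsub>H_smash\<^esub> x \<ominus>\<^bsub>H_smash\<^esub> (\<lambda>a. scalar (lam a))}))"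

section \<open>Left modules over noncommutative rings\<close>

text \<open>Same axioms as the locale \<open>module\<close> of HOL-Algebra, which demands a commutative ring.
  The multiplication and unit fields of the record \<open>M\<close> are irrelevant.\<close>

locale left_module = R?: ring R + M?: abelian_group M
  for R (structure) and M (structure) +
  assumes smult_closed [simp, intro]:
      "\<lbrakk>a \<in> carrier R; x \<in> carrier M\<rbrakk> \<Longrightarrow> a \<odot>\<^bsub>M\<^esub> x \<in> carrier M"
    and smult_l_distr:
      "\<lbrakk>a \<in> carrier R; b \<in> carrier R; x \<in> carrier M\<rbrakk> \<Longrightarrow>
        (a \<oplus>\<^bsub>R\<^esub> b) \<odot>\<^bsub>M\<^esub> x = a \<odot>\<^bsub>M\<^esub> x \<oplus>\<^bsub>M\<^esub> b \<odot>\<^bsub>M\<^esub> x"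
    and smult_r_distr:
      "\<lbrakk>a \<in> carrier R; x \<in> carrier M; y \<in> carrier M\<rbrakk> \<Longrightarrow>
        a \<odot>\<^bsub>M\<^esub> (x \<oplus>\<^bsub>M\<^esub> y) = a \<odot>\<^bsub>M\<^esub> x \<oplus>\<^bsub>M\<^esub> a \<odot>\<^bsub>M\<^esub> y"
    and smult_assoc1:
      "\<lbrakk>a \<in> carrier R; b \<in> carrier R; x \<in> carrier M\<rbrakk> \<Longrightarrow>
        (a \<otimes>\<^bsub>R\<^esub> b) \<odot>\<^bsub>M\<^esub> x = a \<odot>\<^bsub>M\<^esub> (b \<odot>\<^bsub>M\<^esub> x)"
    and smult_one [simp]: "x \<in> carrier M \<Longrightarrow> \<one>\<^bsub>R\<^esub> \<odot>\<^bsub>M\<^esub> x = x"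

definition module_homs :: "'r ring \<Rightarrow> ('r, 'a) module \<Rightarrow> ('r, 'b) module \<Rightarrow> ('a \<Rightarrow> 'b) set"
  where "module_homs R M N =
    {f \<in> carrier M \<rightarrow> carrier N.
      (\<forall>x\<in>carrier M. \<forall>y\<in>carrier M. f (x \<oplus>\<^bsub>M\<^esub> y) = f x \<oplus>\<^bsub>N\<^esub> f y) \<and>
      (\<forall>r\<in>carrier R. \<forall>x\<in>carrier M. f (r \<odot>\<^bsub>M\<^esub> x) = r \<odot>\<^bsub>N\<^esub> f x)}"

definition simple_module :: "'r ring \<Rightarrow> ('r, 'a) module \<Rightarrow> bool"
  where "simple_module R S \<longleftrightarrow>
    left_module R S \<and> carrier S \<noteq> {\<zero>\<^bsub>S\<^esub>} \<and>
    (\<forall>N. submodule N R S \<longrightarrow> N = {\<zero>\<^bsub>S\<^esub>} \<or> N = carrier S)"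

text \<open>Projectivity is the lifting property along surjections \<open>M \<rightarrow> N\<close>. A definition cannot
  quantify over all types, so the carriers of the test modules are sets of fixed types: \<open>'a\<close> for
  \<open>N\<close> and \<open>'a \<Rightarrow> 'r\<close> for \<open>M\<close>. These are large enough for the property to be equivalent to the
  one for test modules of arbitrary type, because they include the canonical surjection onto \<open>P\<close>
  from the free module on the set \<open>carrier P\<close>, whose elements are finitely supported functions
  from \<open>'a\<close> to \<open>'r\<close>.\<close>

definition projective_module :: "'r ring \<Rightarrow> ('r, 'a) module \<Rightarrow> bool"
  where "projective_module R P \<longleftrightarrow>
    left_module R P \<and>
    (\<forall>(M :: ('r, 'a \<Rightarrow> 'r) module) (N :: ('r, 'a) module) q h.
      left_module R M \<and> left_module R N \<and>
      q \<in> module_homs R M N \<and> q ` carrier M = carrier N \<and> h \<in> module_homs R P N \<longrightarrow>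
      (\<exists>h' \<in> module_homs R P M. \<forall>x\<in>carrier P. q (h' x) = h x))"

definition superfluous :: "'r ring \<Rightarrow> ('r, 'a) module \<Rightarrow> 'a set \<Rightarrow> bool"
  where "superfluous R P K \<longleftrightarrow>
    (\<forall>N. submodule N R P \<and> N <+>\<^bsub>P\<^esub> K = carrier P \<longrightarrow> N = carrier P)"

definition projective_cover ::
    "'r ring \<Rightarrow> ('r, 'a) module \<Rightarrow> ('a \<Rightarrow> 'b) \<Rightarrow> ('r, 'b) module \<Rightarrow> bool"
  where "projective_cover R P f S \<longleftrightarrow>
    projective_module R P \<and> f \<in> module_homs R P S \<and> f ` carrier P = carrier S \<and>
    superfluous R P (a_kernel P S f)"

end

theory Submission
  imports Defs
begin

text \<open>The element \<open>z = x\<^sup>p\<close> is central in \<open>H\<^sub>\<lambda>\<close>: on the commutative subalgebra \<open>A\<close> generated by \<open>x\<close> and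
  \<open>G\<close>, the commutator with \<open>y\<close> is a derivation, so it sends \<open>x\<^sup>p\<close> to \<open>p x\<^sup>p\<^sup>-\<^sup>1 \<lambda> = 0\<close>. If \<open>P \<rightarrow> S\<close> were a
  projective cover, its kernel would be the largest proper submodule of \<open>P\<close>. Since
  \<open>P = z P + (1 - z) P\<close>, one of the central elements \<open>w = z\<close> and \<open>w = 1 - z\<close> satisfies \<open>w P = P\<close>. But
  \<open>P\<close> is cyclic and projective, so it embeds into \<open>H\<^sub>\<lambda>\<close>, where the image lies in the intersection
  of all \<open>w\<^sup>n H\<^sub>\<lambda>\<close>. This intersection is zero because \<open>H\<^sub>\<lambda>\<close> is free over \<open>k[x]\<close>: it acts on the
  Ore extension \<open>A[y]\<close>, and \<open>h \<mapsto> h \<cdot> 1\<close> is injective.\<close>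

section \<open>Projective covers of simple modules\<close>

text \<open>The ring \<open>H_alg lam\<close> is given by generators and a relation, so the
  difficulty is to recognise when one of its elements vanishes. No basis theorem is proved for it.
  The Ore extension serves only as an abelian group with operators for \<open>x\<close>,
  \<open>y\<close> and the group elements; once these operators are seen to satisfy the defining
  relations, divisibility by \<open>w^n\<close> in \<open>H_alg lam\<close> becomes divisibility of
  coefficients. Vanishing is carried back by a substitution map \<Phi> from the Ore extension to
  \<open>H_alg lam\<close>, which respects the two left actions and sends 1 to 1, so that it
  recovers \<open>h\<close> from \<open>h * 1\<close>. The elements \<open>z\<close> and
  \<open>1 - z\<close> are chosen for two reasons. They add up to 1, whereas two proper submodules
  of \<open>P\<close> both lie in the kernel and cannot span \<open>P\<close>. And both are
  polynomials in \<open>x\<close> of positive degree, so that only 0 is divisible by all their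
  powers.\<close>

context left_module
begin

lemma smult_r_null [simp]: "a \<in> carrier R \<Longrightarrow> a \<odot>\<^bsub>M\<^esub> \<zero>\<^bsub>M\<^esub> = \<zero>\<^bsub>M\<^esub>"
  by (metis M.add.l_cancel_one' M.zero_closed M.l_zero smult_closed smult_r_distr)

lemma smult_l_null [simp]: "x \<in> carrier M \<Longrightarrow> \<zero>\<^bsub>R\<^esub> \<odot>\<^bsub>M\<^esub> x = \<zero>\<^bsub>M\<^esub>"
  by (metis M.add.l_cancel_one' R.l_zero R.zero_closed smult_closed smult_l_distr)

lemma smult_l_minus: "\<lbrakk>a \<in> carrier R; x \<in> carrier M\<rbrakk> \<Longrightarrow> (\<ominus>\<^bsub>R\<^esub> a) \<odot>\<^bsub>M\<^esub> x = \<ominus>\<^bsub>M\<^esub> (a \<odot>\<^bsub>M\<^esub> x)"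
  by (metis M.minus_equality R.a_inv_closed R.l_neg smult_closed smult_l_distr smult_l_null)

lemma submoduleI:
  assumes "N \<subseteq> carrier M" "N \<noteq> {}"
    and add: "\<And>x y. \<lbrakk>x \<in> N; y \<in> N\<rbrakk> \<Longrightarrow> x \<oplus>\<^bsub>M\<^esub> y \<in> N"
    and smult: "\<And>a x. \<lbrakk>a \<in> carrier R; x \<in> N\<rbrakk> \<Longrightarrow> a \<odot>\<^bsub>M\<^esub> x \<in> N"
  shows "submodule N R M"
proof -
  have "\<ominus>\<^bsub>M\<^esub> x \<in> N" if "x \<in> N" for x
    using that assms(1) smult[of "\<ominus>\<^bsub>R\<^esub> \<one>\<^bsub>R\<^esub>" x] smult_l_minus[of "\<one>\<^bsub>R\<^esub>" x] by auto
  moreover have "\<zero>\<^bsub>M\<^esub> \<in> N"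
    using assms(1,2) smult[of "\<zero>\<^bsub>R\<^esub>"] smult_l_null by (metis R.zero_closed ex_in_conv subset_iff)
  ultimately show ?thesis
    using assms by unfold_locales (auto simp: a_inv_def)
qed

lemma submodule_cyclic: "v \<in> carrier M \<Longrightarrow> submodule ((\<lambda>h. h \<odot>\<^bsub>M\<^esub> v) ` carrier R) R M"
  by (rule submoduleI) (auto simp flip: smult_l_distr smult_assoc1)

text \<open>Over a noncommutative ring \<open>w M\<close> is in general only a subgroup; centrality
  gives \<open>a (w x) = w (a x)\<close>.\<close>

lemma submodule_central_image:
  assumes w: "w \<in> carrier R" and central: "\<And>h. h \<in> carrier R \<Longrightarrow> w \<otimes>\<^bsub>R\<^esub> h = h \<otimes>\<^bsub>R\<^esub> w"
  shows "submodule ((\<lambda>x. w \<odot>\<^bsub>M\<^esub> x) ` carrier M) R M"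
proof (rule submoduleI)
  fix a y assume a: "a \<in> carrier R" and "y \<in> (\<lambda>x. w \<odot>\<^bsub>M\<^esub> x) ` carrier M"
  then obtain x where x: "x \<in> carrier M" "y = w \<odot>\<^bsub>M\<^esub> x" by auto
  then have "a \<odot>\<^bsub>M\<^esub> y = w \<odot>\<^bsub>M\<^esub> (a \<odot>\<^bsub>M\<^esub> x)"
    using a w central[OF a] by (simp flip: smult_assoc1)
  then show "a \<odot>\<^bsub>M\<^esub> y \<in> (\<lambda>x. w \<odot>\<^bsub>M\<^esub> x) ` carrier M"
    using a x by blast
qed (use w in \<open>auto simp flip: smult_r_distr\<close>)

end

lemma module_homs_zero:
  assumes "left_module R M" "left_module R N" "f \<in> module_homs R M N"
  shows "f \<zero>\<^bsub>M\<^esub> = \<zero>\<^bsub>N\<^esub>"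
proof -
  interpret M: left_module R M by fact
  interpret N: left_module R N by fact
  have "f (\<zero>\<^bsub>R\<^esub> \<odot>\<^bsub>M\<^esub> \<zero>\<^bsub>M\<^esub>) = \<zero>\<^bsub>R\<^esub> \<odot>\<^bsub>N\<^esub> f \<zero>\<^bsub>M\<^esub>" "f \<zero>\<^bsub>M\<^esub> \<in> carrier N"
    using assms(3) unfolding module_homs_def by fastforce+
  then show ?thesis by simp
qed

text \<open>The image of \<open>N\<close> is a nonzero submodule of the simple module
  \<open>S\<close>, hence all of \<open>S\<close>. Every \<open>x\<close> in \<open>P\<close> then
  has the same image as some \<open>m\<close> in \<open>N\<close>, so \<open>N\<close> and the
  kernel together span \<open>P\<close>, and superfluity applies. Consequently every proper
  submodule lies in the kernel, and any element outside the kernel generates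
  \<open>P\<close>.\<close>

lemma superfluous_kernel_maximal:
  assumes P: "left_module R P" and S: "simple_module R S"
    and f: "f \<in> module_homs R P S" and K: "superfluous R P (a_kernel P S f)"
    and N: "submodule N R P" and n: "n \<in> N" "f n \<noteq> \<zero>\<^bsub>S\<^esub>"
  shows "N = carrier P"
proof -
  interpret P: left_module R P by fact
  interpret S: left_module R S using S by (simp add: simple_module_def)
  interpret N: submodule N R P by fact
  have NP: "N \<subseteq> carrier P" using N.subset by simp
  have f_add: "f (x \<oplus>\<^bsub>P\<^esub> y) = f x \<oplus>\<^bsub>S\<^esub> f y" 
    if "x \<in> carrier P" "y \<in> carrier P" for x y
    using f that by (auto simp: module_homs_def)
  have f_smult: "f (r \<odot>\<^bsub>P\<^esub> x) = r \<odot>\<^bsub>S\<^esub> f x" if "r \<in> carrier R" "x \<in> carrier P" for r x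
    using f that by (auto simp: module_homs_def)
  have f_carr: "f x \<in> carrier S" if "x \<in> carrier P" for x
    using f that by (auto simp: module_homs_def)
  have add: "x \<oplus>\<^bsub>S\<^esub> y \<in> f ` N" if x: "x \<in> f ` N" and y: "y \<in> f ` N" for x y
  proof -
    obtain a where a: "a \<in> N" "x = f a" using x by (rule imageE)
    obtain b where b: "b \<in> N" "y = f b" using y by (rule imageE)
    have "a \<oplus>\<^bsub>P\<^esub> b \<in> N" using N.m_closed[OF a(1) b(1)] by simp
    moreover have "x \<oplus>\<^bsub>S\<^esub> y = f (a \<oplus>\<^bsub>P\<^esub> b)"
      unfolding a b using f_add[of a b] a(1) b(1) NP by (metis subsetD)
    ultimately show ?thesis by (metis imageI)
  qed
  have smult: "r \<odot>\<^bsub>S\<^esub> x \<in> f ` N" if r: "r \<in> carrier R" and x: "x \<in> f ` N" for r x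
  proof -
    obtain a where a: "a \<in> N" "x = f a" using x by (rule imageE)
    have "r \<odot>\<^bsub>S\<^esub> x = f (r \<odot>\<^bsub>P\<^esub> a)" unfolding a using f_smult r a(1) NP by (metis subsetD)
    then show ?thesis using N.smult_closed[OF r a(1)] by (metis imageI)
  qed
  have "f ` N \<subseteq> carrier S" using NP f_carr by (metis image_subsetI subsetD)
  moreover have "f ` N \<noteq> {}" using n(1) by (metis empty_iff imageI)
  ultimately have "submodule (f ` N) R S" using add smult by (rule S.submoduleI)
  then have fN: "f ` N = carrier S"
    using S n by (auto simp: simple_module_def)
  have "carrier P \<subseteq> N <+>\<^bsub>P\<^esub> a_kernel P S f"
  proof
    fix x assume x: "x \<in> carrier P"
    then obtain m where m: "m \<in> N" "f x = f m" using fN f_carr by (metis imageE)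
    then have mP: "m \<in> carrier P" using NP by blast
    have "f (\<ominus>\<^bsub>P\<^esub> m) = \<ominus>\<^bsub>S\<^esub> f m"
      using f_add[of "\<ominus>\<^bsub>P\<^esub> m" m] module_homs_zero[OF P S.left_module_axioms f] mP f_carr
      by (metis P.M.a_inv_closed P.M.l_neg S.M.minus_equality)
    then have "f (\<ominus>\<^bsub>P\<^esub> m \<oplus>\<^bsub>P\<^esub> x) = \<zero>\<^bsub>S\<^esub>"
      using m mP x f_add[of "\<ominus>\<^bsub>P\<^esub> m" x] f_carr[of m] by (simp add: S.M.l_neg)
    then have "\<ominus>\<^bsub>P\<^esub> m \<oplus>\<^bsub>P\<^esub> x \<in> a_kernel P S f"
      using mP x by (simp add: a_kernel_def')
    moreover have "x = m \<oplus>\<^bsub>P\<^esub> (\<ominus>\<^bsub>P\<^esub> m \<oplus>\<^bsub>P\<^esub> x)"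
      using mP x by (simp add: P.M.r_neg flip: P.M.a_assoc)
    ultimately show "x \<in> N <+>\<^bsub>P\<^esub> a_kernel P S f"
      using m unfolding set_add_def' by blast
  qed
  moreover have "N <+>\<^bsub>P\<^esub> a_kernel P S f \<subseteq> carrier P"
    using NP unfolding set_add_def' by (auto simp: a_kernel_def')
  ultimately show ?thesis
    using K N unfolding superfluous_def by blast
qed

text \<open>Lifting the identity along the surjection from the regular module onto a cyclic module;
  constant functions embed the regular module into the type of the test modules.\<close>

lemma projective_cyclic_embedding:
  fixes P :: "('r, 'p) module"
  assumes P: "projective_module R P" and v: "v \<in> carrier P"
    and cyclic: "(\<lambda>h. h \<odot>\<^bsub>P\<^esub> v) ` carrier R = carrier P"
  obtains s where "s \<in> carrier P \<rightarrow> carrier R"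
    "\<And>a x. \<lbrakk>a \<in> carrier R; x \<in> carrier P\<rbrakk> \<Longrightarrow> s (a \<odot>\<^bsub>P\<^esub> x) = a \<otimes>\<^bsub>R\<^esub> s x"
    "\<And>x. x \<in> carrier P \<Longrightarrow> s x \<odot>\<^bsub>P\<^esub> v = x"
proof -
  interpret P: left_module R P using P by (simp add: projective_module_def)
  define c :: "'r \<Rightarrow> 'p \<Rightarrow> 'r" where "c h = (\<lambda>_. h)" for h
  \<comment> \<open>The point \<open>undefined\<close> is arbitrary: on constant functions
    evaluation at any point inverts \<open>c\<close>.\<close>
  define e :: "('p \<Rightarrow> 'r) \<Rightarrow> 'r" where "e u = u undefined" for u
  have ec [simp]: "e (c h) = h" for h by (simp add: e_def c_def)
  define reg :: "('r, 'p \<Rightarrow> 'r) module" where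
    "reg = \<lparr>carrier = c ` carrier R, mult = undefined, one = undefined, zero = c \<zero>\<^bsub>R\<^esub>,
       add = (\<lambda>u u'. c (e u \<oplus>\<^bsub>R\<^esub> e u')), smult = (\<lambda>h u. c (h \<otimes>\<^bsub>R\<^esub> e u))\<rparr>"
  have reg: "left_module R reg"
  proof (intro left_module.intro left_module_axioms.intro P.R.ring_axioms)
    show "abelian_group reg"
    proof (rule abelian_groupI)
      fix u assume "u \<in> carrier reg"
      then obtain h where h: "h \<in> carrier R" "u = c h" by (auto simp: reg_def)
      then show "\<exists>y\<in>carrier reg. y \<oplus>\<^bsub>reg\<^esub> u = \<zero>\<^bsub>reg\<^esub>"
        by (intro bexI[of _ "c (\<ominus>\<^bsub>R\<^esub> h)"]) (auto simp: reg_def P.R.l_neg)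
    qed (auto simp: reg_def P.R.a_ac)
  qed (auto simp: reg_def P.R.l_distr P.R.r_distr P.R.m_assoc)
  define q where "q u = e u \<odot>\<^bsub>P\<^esub> v" for u
  have q: "q \<in> module_homs R reg P"
    using v by (auto simp: module_homs_def q_def reg_def P.smult_l_distr P.smult_assoc1)
  have q_surj: "q ` carrier reg = carrier P"
    using cyclic by (simp add: q_def reg_def image_image)
  \<comment> \<open>A lift of this map is a right inverse of \<open>q\<close>, which is where
    \<open>s x v = x\<close>, and with it the injectivity of \<open>s\<close>, comes from.\<close>
  have "(\<lambda>x. x) \<in> module_homs R P P"
    by (auto simp: module_homs_def)
  then obtain s' where s': "s' \<in> module_homs R P reg" "\<forall>x\<in>carrier P. q (s' x) = x"
    using P reg q q_surj P.left_module_axioms unfolding projective_module_def by blast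
  have e_closed: "e u \<in> carrier R" if "u \<in> carrier reg" for u
    using that by (auto simp: reg_def)
  show thesis
  proof (rule that[of "e \<circ> s'"])
    show "e \<circ> s' \<in> carrier P \<rightarrow> carrier R"
      using s'(1) e_closed unfolding module_homs_def by (auto dest: funcset_mem)
    show "(e \<circ> s') (a \<odot>\<^bsub>P\<^esub> x) = a \<otimes>\<^bsub>R\<^esub> (e \<circ> s') x" if "a \<in> carrier R" "x \<in> carrier P" for a x
      using s'(1) that by (simp add: module_homs_def reg_def)
    show "(e \<circ> s') x \<odot>\<^bsub>P\<^esub> v = x" if "x \<in> carrier P" for x
      using s'(2) that by (simp add: q_def)
  qed
qed

text \<open>Linearity of the embedding \<open>s\<close> turns \<open>x = w y\<close> into
  \<open>s x = w (s y)\<close>. Iterating this along \<open>w P = P\<close> puts \<open>s v\<close>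
  into every \<open>w^n R\<close>, so separation gives \<open>s v = 0\<close>, and then
  \<open>v = (s v) v = 0\<close>.\<close>

lemma projective_cyclic_not_divisible:
  fixes P :: "('r, 'p) module"
  assumes P: "projective_module R P" and v: "v \<in> carrier P"
    and cyclic: "(\<lambda>h. h \<odot>\<^bsub>P\<^esub> v) ` carrier R = carrier P"
    and w: "w \<in> carrier R"
    and sep: "\<And>h. \<lbrakk>h \<in> carrier R; \<And>n::nat. \<exists>h'\<in>carrier R. h = w [^]\<^bsub>R\<^esub> n \<otimes>\<^bsub>R\<^esub> h'\<rbrakk> \<Longrightarrow> h = \<zero>\<^bsub>R\<^esub>"
    and div: "(\<lambda>x. w \<odot>\<^bsub>P\<^esub> x) ` carrier P = carrier P"
  shows "v = \<zero>\<^bsub>P\<^esub>"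
proof -
  interpret P: left_module R P using P by (simp add: projective_module_def)
  obtain s where s: "s \<in> carrier P \<rightarrow> carrier R"
    "\<And>a x. \<lbrakk>a \<in> carrier R; x \<in> carrier P\<rbrakk> \<Longrightarrow> s (a \<odot>\<^bsub>P\<^esub> x) = a \<otimes>\<^bsub>R\<^esub> s x"
    "\<And>x. x \<in> carrier P \<Longrightarrow> s x \<odot>\<^bsub>P\<^esub> v = x"
    using projective_cyclic_embedding[OF P v cyclic] by blast
  have "\<exists>h'\<in>carrier R. s x = w [^]\<^bsub>R\<^esub> n \<otimes>\<^bsub>R\<^esub> h'" if "x \<in> carrier P" for x and n :: nat
    using that
  proof (induction n arbitrary: x)
    case 0
    then have "s x \<in> carrier R" using s(1) by blast
    then show ?case by (intro bexI[of _ "s x"]) auto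
  next
    case (Suc n)
    obtain y where y: "y \<in> carrier P" "x = w \<odot>\<^bsub>P\<^esub> y"
      using div Suc.prems by blast
    obtain h' where h': "h' \<in> carrier R" "s y = w [^]\<^bsub>R\<^esub> n \<otimes>\<^bsub>R\<^esub> h'"
      using Suc.IH y(1) by blast
    have "s x = w [^]\<^bsub>R\<^esub> Suc n \<otimes>\<^bsub>R\<^esub> h'"
      using y s(2)[OF w y(1)] h' w P.R.nat_pow_Suc2[OF w] by (simp add: P.R.m_assoc del: P.R.nat_pow_Suc)
    then show ?case using h' by blast
  qed
  then have "s v = \<zero>\<^bsub>R\<^esub>"
    using sep[of "s v"] s(1) v by blast
  then show ?thesis using s(3)[OF v] v by simp
qed

text \<open>Take \<open>v\<close> outside the kernel, so that it generates \<open>P\<close>. If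
  \<open>u v\<close> also lay outside for \<open>u = z\<close> or \<open>u = 1 - z\<close>, the
  submodule \<open>u P\<close> would be all of \<open>P\<close>, which forces \<open>v = 0\<close>.
  Hence \<open>z v\<close> and \<open>(1 - z) v\<close> both lie in the kernel, although their sum
  is \<open>v\<close>.\<close>

theorem no_projective_cover_if_central_separated:
  fixes S :: "('r, 's) module" and P :: "('r, 'p) module"
  assumes S: "simple_module R S"
    and z: "z \<in> carrier R" and central: "\<And>h. h \<in> carrier R \<Longrightarrow> z \<otimes>\<^bsub>R\<^esub> h = h \<otimes>\<^bsub>R\<^esub> z"
    and sep: "\<And>w h. \<lbrakk>w = z \<or> w = \<one>\<^bsub>R\<^esub> \<ominus>\<^bsub>R\<^esub> z; h \<in> carrier R;
      \<And>n::nat. \<exists>h'\<in>carrier R. h = w [^]\<^bsub>R\<^esub> n \<otimes>\<^bsub>R\<^esub> h'\<rbrakk> \<Longrightarrow> h = \<zero>\<^bsub>R\<^esub>"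
  shows "\<not> projective_cover R P f S"
proof
  assume "projective_cover R P f S"
  then have P: "projective_module R P" and f: "f \<in> module_homs R P S"
    and f_surj: "f ` carrier P = carrier S" and K: "superfluous R P (a_kernel P S f)"
    by (auto simp: projective_cover_def)
  interpret P: left_module R P using P by (simp add: projective_module_def)
  interpret S: left_module R S using S by (simp add: simple_module_def)
  define w where "w = \<one>\<^bsub>R\<^esub> \<ominus>\<^bsub>R\<^esub> z"
  have w: "w \<in> carrier R" using z by (simp add: w_def)
  have zw: "z \<oplus>\<^bsub>R\<^esub> w = \<one>\<^bsub>R\<^esub>"
    using z by (simp add: w_def P.R.minus_eq P.R.a_lcomm[of z "\<one>\<^bsub>R\<^esub>"] P.R.r_neg)
  have w_central: "w \<otimes>\<^bsub>R\<^esub> h = h \<otimes>\<^bsub>R\<^esub> w" if "h \<in> carrier R" for h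
    using that z central[OF that] by (simp add: w_def P.R.minus_eq P.R.l_distr P.R.r_distr P.R.l_minus P.R.r_minus)
  have "\<exists>v\<in>carrier P. f v \<noteq> \<zero>\<^bsub>S\<^esub>"
  proof (rule ccontr)
    assume "\<not> ?thesis"
    then have "carrier S \<subseteq> {\<zero>\<^bsub>S\<^esub>}" using f_surj by auto
    then show False using S S.M.zero_closed unfolding simple_module_def by blast
  qed
  then obtain v where v: "v \<in> carrier P" "f v \<noteq> \<zero>\<^bsub>S\<^esub>" by blast
  note maximal = superfluous_kernel_maximal[OF P.left_module_axioms S f K]
  have cyclic: "(\<lambda>h. h \<odot>\<^bsub>P\<^esub> v) ` carrier R = carrier P"
    using maximal[OF P.submodule_cyclic[OF v(1)], of v] v
    by (metis P.R.one_closed P.smult_one imageI)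
  have f_zero: "f \<zero>\<^bsub>P\<^esub> = \<zero>\<^bsub>S\<^esub>"
    by (rule module_homs_zero[OF P.left_module_axioms S.left_module_axioms f])
  have ker: "f (u \<odot>\<^bsub>P\<^esub> v) = \<zero>\<^bsub>S\<^esub>" if "u = z \<or> u = w" for u
  proof (rule ccontr)
    assume *: "f (u \<odot>\<^bsub>P\<^esub> v) \<noteq> \<zero>\<^bsub>S\<^esub>"
    have u: "u \<in> carrier R" using that z w by auto
    have u_central: "u \<otimes>\<^bsub>R\<^esub> h = h \<otimes>\<^bsub>R\<^esub> u" if "h \<in> carrier R" for h
      using \<open>u = z \<or> u = w\<close> central[OF that] w_central[OF that] by auto
    have "(\<lambda>x. u \<odot>\<^bsub>P\<^esub> x) ` carrier P = carrier P"
      using maximal[OF P.submodule_central_image[OF u u_central] _ *] v(1) by blast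
    then have "v = \<zero>\<^bsub>P\<^esub>"
      using projective_cyclic_not_divisible[OF P v(1) cyclic u] sep that w_def by metis
    then show False using v f_zero by simp
  qed
  have "f v = f (z \<odot>\<^bsub>P\<^esub> v \<oplus>\<^bsub>P\<^esub> w \<odot>\<^bsub>P\<^esub> v)"
    using v z w zw by (simp flip: P.smult_l_distr)
  also have "\<dots> = f (z \<odot>\<^bsub>P\<^esub> v) \<oplus>\<^bsub>S\<^esub> f (w \<odot>\<^bsub>P\<^esub> v)"
    using f v z w by (simp add: module_homs_def)
  also have "\<dots> = \<zero>\<^bsub>S\<^esub>"
    using ker by simp
  finally show False using v by simp
qed

section \<open>Free algebras and their evaluation\<close>

lemma poly_mapping_single_induct [case_names single add]:
  fixes f :: "'a \<Rightarrow>\<^sub>0 'b::comm_monoid_add"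
  assumes single: "\<And>u c. P (Poly_Mapping.single u c)"
    and add: "\<And>f g. \<lbrakk>P f; P g\<rbrakk> \<Longrightarrow> P (f + g)"
  shows "P f"
proof -
  have "P (\<Sum>u\<in>U. Poly_Mapping.single u (Poly_Mapping.lookup f u))" if "finite U" for U
    using that
  proof induction
    case empty
    then show ?case using single[of _ 0] by simp
  qed (simp add: single add)
  moreover have "(\<Sum>u\<in>Poly_Mapping.keys f. Poly_Mapping.single u (Poly_Mapping.lookup f u)) = f"
    by (rule poly_mapping_eqI)
      (simp add: lookup_sum lookup_single when_def in_keys_iff if_distrib cong: if_cong)
  ultimately show ?thesis by (metis finite_keys)
qed

text \<open>The map \<open>free_alg_hom\<close> takes values in free algebras only. The same formula
  is needed for values in a ring of operators, so the target is any ring with a coefficient map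
  \<open>\<iota>\<close> that commutes with the images of the letters.\<close>

locale alg_eval =
  fixes \<iota> :: "'k::field \<Rightarrow> 'e::ring_1" and \<phi> :: "'v \<Rightarrow> 'e"
  assumes coeff_add: "\<iota> (a + b) = \<iota> a + \<iota> b"
    and coeff_mult: "\<iota> (a * b) = \<iota> a * \<iota> b"
    and coeff_one [simp]: "\<iota> 1 = 1"
    and coeff_comm: "\<iota> c * \<phi> v = \<phi> v * \<iota> c"
begin

definition ev :: "('v, 'k) free_alg \<Rightarrow> 'e"
  where "ev f = (\<Sum>u\<in>Poly_Mapping.keys f.
    \<iota> (Poly_Mapping.lookup f u) * prod_list (map \<phi> (letters u)))"

lemma coeff_zero [simp]: "\<iota> 0 = 0"
  using coeff_add[of 0 0] by simp

text \<open>The support of a sum may be smaller than the union of the supports; a common index set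
  makes the sums comparable.\<close>

lemma ev_superset:
  assumes "finite K" "Poly_Mapping.keys f \<subseteq> K"
  shows "ev f = (\<Sum>u\<in>K. \<iota> (Poly_Mapping.lookup f u) * prod_list (map \<phi> (letters u)))"
  unfolding ev_def using assms by (intro sum.mono_neutral_left) (auto simp: in_keys_iff)

lemma ev_add: "ev (f + g) = ev f + ev g"
proof -
  have "finite (Poly_Mapping.keys f \<union> Poly_Mapping.keys g)" by simp
  note * = ev_superset[OF this]
  show ?thesis
    using Poly_Mapping.keys_add[of f g]
    by (simp add: * lookup_add coeff_add distrib_right sum.distrib)
qed

lemma ev_single: "ev (Poly_Mapping.single u c) = \<iota> c * prod_list (map \<phi> (letters u))"
  by (subst ev_superset[of "{u}"]) auto

lemma ev_scalar [simp]: "ev (scalar c) = \<iota> c"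
  by (simp add: scalar_def ev_single zero_fmon_def)

lemma ev_gen [simp]: "ev (gen v) = \<phi> v"
  by (simp add: gen_def ev_single)

lemma coeff_comm_prod_list: "\<iota> c * prod_list (map \<phi> vs) = prod_list (map \<phi> vs) * \<iota> c"
proof (induction vs)
  case (Cons v vs)
  have "\<iota> c * (\<phi> v * prod_list (map \<phi> vs)) = \<phi> v * (\<iota> c * prod_list (map \<phi> vs))"
    using coeff_comm[of c v] by (metis mult.assoc)
  then show ?case using Cons by (simp add: mult.assoc)
qed simp

lemma ev_mult: "ev (f * g) = ev f * ev g"
proof (induction f rule: poly_mapping_single_induct)
  case (single u c)
  show ?case
  proof (induction g rule: poly_mapping_single_induct)
    case (single v d)
    have "\<iota> c * \<iota> d * (prod_list (map \<phi> (letters u)) * prod_list (map \<phi> (letters v)))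
      = \<iota> c * (\<iota> d * prod_list (map \<phi> (letters u))) * prod_list (map \<phi> (letters v))"
      by (simp add: mult.assoc)
    then show ?case
      by (simp add: mult_single ev_single coeff_mult plus_fmon_def coeff_comm_prod_list[of d] mult.assoc)
  qed (simp add: distrib_left ev_add)
qed (simp add: distrib_right ev_add)

lemma ev_one [simp]: "ev 1 = 1"
  using ev_scalar[of 1] by (simp add: scalar_def)

end

lemma scalar_add: "scalar (a + b) = scalar a + scalar b"
  by (simp add: scalar_def single_add)

lemma scalar_mult: "scalar (a * b) = scalar a * scalar b"
  by (simp add: scalar_def mult_single)

lemma scalar_mult_rev: "scalar (a * b) = scalar b * scalar a"
  by (simp add: mult.commute flip: scalar_mult)

lemma scalar_one: "scalar 1 = 1"
  by (simp add: scalar_def)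

lemma scalar_zero: "scalar 0 = 0"
  by (simp add: scalar_def)

lemma scalar_comm: "scalar c * f = f * scalar c"
  by (induction f rule: poly_mapping_single_induct)
    (simp_all add: scalar_def mult_single distrib_left distrib_right mult.commute)

lemma free_alg_induct [case_names scalar gen add mult]:
  assumes scalar: "\<And>c. P (scalar c)" and gen: "\<And>v. P (gen v)"
    and add: "\<And>f g. \<lbrakk>P f; P g\<rbrakk> \<Longrightarrow> P (f + g)" and mult: "\<And>f g. \<lbrakk>P f; P g\<rbrakk> \<Longrightarrow> P (f * g)"
  shows "P f"
proof (induction f rule: poly_mapping_single_induct)
  case (single u c)
  have "P (Poly_Mapping.single (FMon vs) c)" for vs
  proof (induction vs)
    case Nil
    then show ?case using scalar[of c] by (simp add: scalar_def zero_fmon_def)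
  next
    case (Cons v vs)
    have "Poly_Mapping.single (FMon (v # vs)) c = gen v * Poly_Mapping.single (FMon vs) c"
      by (simp add: gen_def mult_single plus_fmon_def)
    then show ?case using gen mult Cons by simp
  qed
  then show ?case by (metis fmon.collapse)
qed (rule add)

interpretation scalar: alg_eval scalar \<phi>
  rewrites "alg_eval.ev scalar \<phi> = free_alg_hom \<phi>"
  for \<phi> :: "'v \<Rightarrow> ('w, 'k::field) free_alg"
proof -
  show "alg_eval scalar \<phi>"
    by unfold_locales (rule scalar_add scalar_mult scalar_one scalar_comm)+
  then show "alg_eval.ev scalar \<phi> = free_alg_hom \<phi>"
    by (auto simp: fun_eq_iff alg_eval.ev_def free_alg_hom_def)
qed

lemma mat_act_add: "mat_act A (f + g) = mat_act A f + mat_act A g"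
  and mat_act_mult: "mat_act A (f * g) = mat_act A f * mat_act A g"
  and mat_act_scalar: "mat_act A (scalar c) = scalar c"
  by (simp_all add: mat_act_def scalar.ev_add scalar.ev_mult scalar.ev_scalar)

lemma mat_act_gen: "mat_act A (gen j) = (\<Sum>i\<in>UNIV. scalar (A $ i $ j) * gen i)"
  by (simp add: mat_act_def free_alg_hom_gen)

lemma mat_act_one_mat: "mat_act (mat 1) f = f"
proof (induction f rule: free_alg_induct)
  case (gen v)
  have "mat_act (mat 1) (gen v) = (\<Sum>i\<in>UNIV. if i = v then gen i else 0)"
    unfolding mat_act_gen by (intro sum.cong) (auto simp: mat_def scalar_one scalar_zero)
  then show ?case by simp
qed (simp_all add: mat_act_add mat_act_mult mat_act_scalar)

text \<open>Both sides are algebra maps in \<open>f\<close>, so generators suffice. There it is the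
  composition of linear substitutions, and taking coordinates as columns makes it a left
  action.\<close>

lemma mat_act_matrix_mult: "mat_act (A ** B) f = mat_act A (mat_act B f)"
proof (induction f rule: free_alg_induct)
  case (gen v)
  have "mat_act (A ** B) (gen v)
    = scalar (A $ 1 $ 1 * B $ 1 $ v + A $ 1 $ 2 * B $ 2 $ v) * gen 1
      + scalar (A $ 2 $ 1 * B $ 1 $ v + A $ 2 $ 2 * B $ 2 $ v) * gen 2"
    by (simp add: mat_act_gen sum_2 matrix_matrix_mult_def)
  also have "\<dots> = scalar (B $ 1 $ v) * (scalar (A $ 1 $ 1) * gen 1 + scalar (A $ 2 $ 1) * gen 2)
      + scalar (B $ 2 $ v) * (scalar (A $ 1 $ 2) * gen 1 + scalar (A $ 2 $ 2) * gen 2)"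
    \<comment> \<open>\<open>scalar_mult_rev\<close> puts the entry of \<open>B\<close> in front of
      each product, so that it can be factored out.\<close>
    unfolding scalar_add scalar_mult_rev distrib_left distrib_right mult.assoc
    by (simp only: ac_simps)
  also have "\<dots> = mat_act A (mat_act B (gen v))"
    by (simp add: mat_act_gen mat_act_add mat_act_mult mat_act_scalar sum_2)
  finally show ?case .
qed (simp_all add: mat_act_add mat_act_mult mat_act_scalar)

section \<open>The cyclic group\<close>

definition unip :: "'k::field \<Rightarrow> 'k ^ 2 ^ 2"
  where "unip t = vector [vector [1, t], vector [0, 1]]"

lemma unip_nth [simp]:
  "unip t $ 1 $ 1 = 1" "unip t $ 1 $ 2 = t" "unip t $ 2 $ 1 = 0" "unip t $ 2 $ 2 = 1"
  by (simp_all add: unip_def)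

lemma mat2_eqI:
  assumes "A $ 1 $ 1 = B $ 1 $ 1" "A $ 1 $ 2 = B $ 1 $ 2" "A $ 2 $ 1 = B $ 2 $ 1" "A $ 2 $ 2 = B $ 2 $ 2"
  shows "(A :: 'a ^ 2 ^ 2) = B"
  using assms by (simp add: vec_eq_iff forall_2)

lemma unip_inject [simp]: "unip s = unip t \<longleftrightarrow> s = t"
  by (metis unip_nth(2))

lemma unip_mult: "unip s ** unip t = unip (s + t)"
  by (rule mat2_eqI) (simp_all add: matrix_matrix_mult_def sum_2 add.commute)

lemma unip_0: "unip 0 = mat 1"
  by (rule mat2_eqI) (simp_all add: mat_def)

lemma g_mat_eq_unip: "g_mat = unip 1"
  by (simp add: g_mat_def unip_def)

lemma SL2_prime_group: "group (SL2_prime :: ('k::field ^ 2 ^ 2) monoid)"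
proof (rule groupI)
  let ?G = "SL2_prime :: ('k ^ 2 ^ 2) monoid"
  have mat1: "(mat 1 :: 'k ^ 2 ^ 2) $ i $ j \<in> range of_int" for i j
    by (auto simp: mat_def intro: range_eqI[of _ _ 0] range_eqI[of _ _ 1])
  then show "\<one>\<^bsub>?G\<^esub> \<in> carrier ?G" by (simp add: SL2_prime_def)
  fix A B :: "'k ^ 2 ^ 2"
  assume A: "A \<in> carrier ?G"
  show "\<exists>C\<in>carrier ?G. C \<otimes>\<^bsub>?G\<^esub> A = \<one>\<^bsub>?G\<^esub>"
  proof (rule bexI)
    \<comment> \<open>The adjugate is a left inverse because the determinant is 1, and up to sign
      its entries are those of \<open>A\<close>.\<close>
    let ?C = "vector [vector [A $ 2 $ 2, - A $ 1 $ 2], vector [- A $ 2 $ 1, A $ 1 $ 1]] :: 'k ^ 2 ^ 2"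
    show "?C \<in> carrier ?G"
      using A by (auto simp: SL2_prime_def det_2 forall_2 algebra_simps) (metis of_int_minus rangeE rangeI)+
    show "?C \<otimes>\<^bsub>?G\<^esub> A = \<one>\<^bsub>?G\<^esub>"
    proof -
      have "?C ** A = mat 1"
        using A by (intro mat2_eqI)
          (auto simp: SL2_prime_def det_2 matrix_matrix_mult_def sum_2 mat_def algebra_simps)
      then show ?thesis by (simp add: SL2_prime_def)
    qed
  qed
  assume B: "B \<in> carrier ?G"
  have "(\<Sum>k\<in>UNIV. A $ i $ k * B $ k $ j) \<in> range of_int" for i j
    using A B unfolding SL2_prime_def sum_2 by (auto simp: image_iff) (metis of_int_add of_int_mult)
  then have "\<forall>i j. (A ** B) $ i $ j \<in> range of_int" by (simp add: matrix_matrix_mult_def)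
  then show "A \<otimes>\<^bsub>?G\<^esub> B \<in> carrier ?G"
    using A B by (simp add: SL2_prime_def det_mul)
qed (auto simp: SL2_prime_def matrix_mul_assoc)

lemma unip_int_in_SL2_prime: "unip (of_int i) \<in> carrier SL2_prime"
  by (auto simp: SL2_prime_def det_2 forall_2 intro: range_eqI[of _ _ 0] range_eqI[of _ _ 1])

lemma cyc_G_mult: "A \<otimes>\<^bsub>cyc_G\<^esub> B = A ** B"
  by (simp add: cyc_G_def subgroup_generated_def SL2_prime_def)

lemma cyc_G_one: "\<one>\<^bsub>cyc_G\<^esub> = mat 1"
  by (simp add: cyc_G_def subgroup_generated_def SL2_prime_def)

lemma cyc_G_group: "group cyc_G"
  unfolding cyc_G_def by (rule group.group_subgroup_generated[OF SL2_prime_group])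

text \<open>The matrices on the right form a subgroup containing the generator; conversely the
  powers of the generator and their inverses exhaust them. From here on, the additive group of the
  prime field can index the group.\<close>

lemma cyc_G_carrier: "carrier (cyc_G :: ('k::field ^ 2 ^ 2) monoid) = unip ` range of_int"
proof
  let ?G = "SL2_prime :: ('k ^ 2 ^ 2) monoid"
  interpret G: group ?G by (rule SL2_prime_group)
  interpret C: group "cyc_G :: ('k ^ 2 ^ 2) monoid" by (rule cyc_G_group)
  have g: "unip 1 \<in> carrier ?G"
    using unip_int_in_SL2_prime[of 1] by simp
  have inv: "inv\<^bsub>?G\<^esub> (unip (of_int i)) = unip (of_int (- i))" for i
    using unip_int_in_SL2_prime[of i] unip_int_in_SL2_prime[of "-i"]
    by (intro G.inv_equality) (auto simp: SL2_prime_def unip_mult unip_0)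
  have carrier: "carrier cyc_G = generate ?G {unip 1}"
    using g by (simp add: cyc_G_def carrier_subgroup_generated g_mat_eq_unip)
  show "carrier cyc_G \<subseteq> (unip ` range of_int :: ('k ^ 2 ^ 2) set)"
    unfolding carrier
  proof (rule G.generate_subgroup_incl)
    show "subgroup (unip ` range of_int) ?G"
    proof (rule G.subgroupI)
      fix a b :: "'k ^ 2 ^ 2"
      assume a: "a \<in> unip ` range of_int"
      then obtain i where i: "a = unip (of_int i)" by blast
      show "inv\<^bsub>?G\<^esub> a \<in> unip ` range of_int" unfolding i inv by blast
      assume "b \<in> unip ` range of_int"
      then obtain j where "b = unip (of_int j)" by blast
      with i have "a \<otimes>\<^bsub>?G\<^esub> b = unip (of_int (i + j))" by (simp add: SL2_prime_def unip_mult)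
      then show "a \<otimes>\<^bsub>?G\<^esub> b \<in> unip ` range of_int" by blast
    qed (auto simp: unip_int_in_SL2_prime)
  qed (auto intro!: imageI range_eqI[of _ _ 1])
  have nat: "unip (of_nat n :: 'k) \<in> carrier cyc_G" for n
  proof (induction n)
    case 0
    then show ?case using C.one_closed by (simp add: cyc_G_one unip_0)
  next
    case (Suc n)
    have "unip 1 \<in> carrier (cyc_G :: ('k ^ 2 ^ 2) monoid)"
      unfolding carrier by (simp add: generate.incl)
    from C.m_closed[OF this Suc] show ?case by (simp add: cyc_G_mult unip_mult)
  qed
  have "unip (of_int i :: 'k) \<in> carrier cyc_G" for i
  proof (cases i rule: int_cases2)
    case (nonpos n)
    let ?A = "unip (of_nat n) :: 'k ^ 2 ^ 2"
    \<comment> \<open>Membership of \<open>unip (- of_nat n)\<close> is still unknown at this point,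
      so it is identified with the inverse by matrix multiplication alone.\<close>
    have "inv\<^bsub>cyc_G\<^esub> ?A = inv\<^bsub>cyc_G\<^esub> ?A ** (?A ** unip (- of_nat n))"
      by (simp add: unip_mult unip_0)
    also have "\<dots> = unip (- of_nat n)"
      using C.l_inv[OF nat[of n]] by (simp add: matrix_mul_assoc cyc_G_mult cyc_G_one)
    finally have "inv\<^bsub>cyc_G\<^esub> ?A = unip (- of_nat n)" .
    then show ?thesis using nonpos C.inv_closed[OF nat[of n]] by simp
  qed (use nat in simp)
  then show "(unip ` range of_int :: ('k ^ 2 ^ 2) set) \<subseteq> carrier cyc_G"
    by auto
qed

lemma finite_range_of_int:
  assumes "CHAR('k::field) > 0"
  shows "finite (range (of_int :: int \<Rightarrow> 'k))"
proof (rule finite_subset)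
  show "range (of_int :: int \<Rightarrow> 'k) \<subseteq> of_int ` {0..<int CHAR('k)}"
  proof
    fix x :: 'k assume "x \<in> range of_int"
    then obtain i where i: "x = of_int i" by auto
    have "of_int (i mod int CHAR('k)) = (of_int i :: 'k)"
    proof -
      have "(of_int i :: 'k) = of_int (int CHAR('k) * (i div int CHAR('k)) + i mod int CHAR('k))"
        by simp
      also have "\<dots> = of_int (i mod int CHAR('k))"
        unfolding of_int_add of_int_mult by simp
      finally show ?thesis by simp
    qed
    then show "x \<in> of_int ` {0..<int CHAR('k)}"
      using i assms by (intro image_eqI[of _ _ "i mod int CHAR('k)"]) auto
  qed
qed simp

section \<open>Smash products\<close>

locale smash_product = group G for G :: "('g, 'n) monoid_scheme" (structure) +
  fixes act :: "'g \<Rightarrow> 'r \<Rightarrow> 'r::ring_1"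
  assumes finite_carrier: "finite (carrier G)"
    and act_add: "a \<in> carrier G \<Longrightarrow> act a (r + s) = act a r + act a s"
    and act_times: "a \<in> carrier G \<Longrightarrow> act a (r * s) = act a r * act a s"
    and act_1: "a \<in> carrier G \<Longrightarrow> act a 1 = 1"
    and act_mult: "\<lbrakk>a \<in> carrier G; b \<in> carrier G\<rbrakk> \<Longrightarrow> act (a \<otimes> b) r = act a (act b r)"
    and act_one: "act \<one> r = r"
begin

abbreviation "RG \<equiv> smash G act"

lemma act_0: "a \<in> carrier G \<Longrightarrow> act a 0 = 0"
  using act_add[of a 0 0] by simp

lemma act_sum: "a \<in> carrier G \<Longrightarrow> act a (\<Sum>i\<in>I. f i) = (\<Sum>i\<in>I. act a (f i))"
  by (induction I rule: infinite_finite_induct) (simp_all add: act_0 act_add)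

lemma smash_carrier: "f \<in> carrier RG \<longleftrightarrow> (\<forall>a. a \<notin> carrier G \<longrightarrow> f a = 0)"
  by (simp add: smash_def)

lemma smash_add: "(f \<oplus>\<^bsub>RG\<^esub> h) a = f a + h a"
  by (simp add: smash_def)

lemma smash_zero: "\<zero>\<^bsub>RG\<^esub> a = 0"
  by (simp add: smash_def)

lemma smash_one: "\<one>\<^bsub>RG\<^esub> a = (if a = \<one> then 1 else 0)"
  by (simp add: smash_def)

lemma smash_mult_outside: "c \<notin> carrier G \<Longrightarrow> (f \<otimes>\<^bsub>RG\<^esub> h) c = 0"
  by (auto simp: smash_def intro!: sum.neutral)

text \<open>In a group a factorisation of \<open>c\<close> is determined by its first factor, so the
  sum over pairs becomes a sum over \<open>a\<close>.\<close>

lemma smash_mult: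
  assumes "c \<in> carrier G"
  shows "(f \<otimes>\<^bsub>RG\<^esub> h) c = (\<Sum>a\<in>carrier G. f a * act a (h (inv a \<otimes> c)))"
proof -
  have "(f \<otimes>\<^bsub>RG\<^esub> h) c = (\<Sum>(a, b) | a \<in> carrier G \<and> b \<in> carrier G \<and> a \<otimes> b = c. f a * act a (h b))"
    by (simp add: smash_def)
  also have "\<dots> = (\<Sum>a\<in>carrier G. f a * act a (h (inv a \<otimes> c)))"
    using assms
    by (intro sum.reindex_bij_witness[of _ "\<lambda>a. (a, inv a \<otimes> c)" fst])
      (auto simp: inv_solve_left m_assoc[symmetric])
  finally show ?thesis .
qed

lemma sum_translate:
  assumes "b \<in> carrier G"
  shows "(\<Sum>a\<in>carrier G. F (b \<otimes> a)) = (\<Sum>a\<in>carrier G. F a)"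
  using assms
  by (intro sum.reindex_bij_witness[of _ "\<lambda>a. inv b \<otimes> a" "\<lambda>a. b \<otimes> a"]) (auto simp: m_assoc[symmetric])

lemma smash_assoc: "(f \<otimes>\<^bsub>RG\<^esub> h) \<otimes>\<^bsub>RG\<^esub> k = f \<otimes>\<^bsub>RG\<^esub> (h \<otimes>\<^bsub>RG\<^esub> k)"
proof
  fix c show "((f \<otimes>\<^bsub>RG\<^esub> h) \<otimes>\<^bsub>RG\<^esub> k) c = (f \<otimes>\<^bsub>RG\<^esub> (h \<otimes>\<^bsub>RG\<^esub> k)) c"
  proof (cases "c \<in> carrier G")
    case c: True
    have "((f \<otimes>\<^bsub>RG\<^esub> h) \<otimes>\<^bsub>RG\<^esub> k) c
      = (\<Sum>a\<in>carrier G. \<Sum>b\<in>carrier G. f b * act b (h (inv b \<otimes> a)) * act a (k (inv a \<otimes> c)))"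
      using c by (simp add: smash_mult sum_distrib_right)
    also have "\<dots> = (\<Sum>b\<in>carrier G. \<Sum>a\<in>carrier G. f b * act b (h (inv b \<otimes> a)) * act a (k (inv a \<otimes> c)))"
      by (rule sum.swap)
    also have "\<dots> = (\<Sum>b\<in>carrier G. \<Sum>a\<in>carrier G. f b * (act b (h a) * act (b \<otimes> a) (k (inv (b \<otimes> a) \<otimes> c))))"
    \<comment> \<open>For fixed \<open>b\<close>, replacing \<open>a\<close> by \<open>b a\<close>
      permutes the group and turns the product of \<open>inv b\<close> and \<open>a\<close> into
      \<open>a\<close>.\<close>
    proof (rule sum.cong[OF refl])
      fix b assume b: "b \<in> carrier G"
      show "(\<Sum>a\<in>carrier G. f b * act b (h (inv b \<otimes> a)) * act a (k (inv a \<otimes> c)))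
        = (\<Sum>a\<in>carrier G. f b * (act b (h a) * act (b \<otimes> a) (k (inv (b \<otimes> a) \<otimes> c))))"
        by (subst sum_translate[OF b, symmetric], rule sum.cong)
          (use b in \<open>auto simp: m_assoc[symmetric] mult.assoc\<close>)
    qed
    also have "\<dots> = (f \<otimes>\<^bsub>RG\<^esub> (h \<otimes>\<^bsub>RG\<^esub> k)) c"
      using c by (simp add: smash_mult act_sum act_times act_mult sum_distrib_left inv_mult_group m_assoc)
    finally show ?thesis .
  qed (simp add: smash_mult_outside)
qed

lemma smash_ring: "ring RG"
proof (rule ringI)
  show "abelian_group RG"
  proof (rule abelian_groupI)
    fix f assume "f \<in> carrier RG"
    then show "\<exists>h\<in>carrier RG. h \<oplus>\<^bsub>RG\<^esub> f = \<zero>\<^bsub>RG\<^esub>"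
      by (intro bexI[of _ "\<lambda>a. - f a"]) (auto simp: smash_carrier smash_add smash_zero fun_eq_iff)
  qed (auto simp: smash_carrier smash_add smash_zero fun_eq_iff algebra_simps)
  show "Group.monoid RG"
  proof (rule monoidI)
    fix f assume f: "f \<in> carrier RG"
    show "\<one>\<^bsub>RG\<^esub> \<otimes>\<^bsub>RG\<^esub> f = f"
    proof
      fix c show "(\<one>\<^bsub>RG\<^esub> \<otimes>\<^bsub>RG\<^esub> f) c = f c"
      proof (cases "c \<in> carrier G")
        case True
        then have "(\<one>\<^bsub>RG\<^esub> \<otimes>\<^bsub>RG\<^esub> f) c = (\<Sum>a\<in>carrier G. if a = \<one> then f c else 0)"
          unfolding smash_mult[OF True] by (intro sum.cong) (auto simp: smash_one act_one)
        then show ?thesis using finite_carrier by simp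
      qed (use f in \<open>simp add: smash_mult_outside smash_carrier\<close>)
    qed
    show "f \<otimes>\<^bsub>RG\<^esub> \<one>\<^bsub>RG\<^esub> = f"
    proof
      fix c show "(f \<otimes>\<^bsub>RG\<^esub> \<one>\<^bsub>RG\<^esub>) c = f c"
      proof (cases "c \<in> carrier G")
        case True
        have "inv a \<otimes> c = \<one> \<longleftrightarrow> a = c" if "a \<in> carrier G" for a
          using that True by (metis inv_closed inv_equality inv_inv l_inv)
        then have "(f \<otimes>\<^bsub>RG\<^esub> \<one>\<^bsub>RG\<^esub>) c = (\<Sum>a\<in>carrier G. if a = c then f c else 0)"
          unfolding smash_mult[OF True] by (intro sum.cong) (auto simp: smash_one act_1 act_0)
        then show ?thesis using finite_carrier True by simp
      qed (use f in \<open>simp add: smash_mult_outside smash_carrier\<close>)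
    qed
  qed (auto simp: smash_carrier smash_mult_outside smash_assoc smash_one)
  show "(f \<oplus>\<^bsub>RG\<^esub> h) \<otimes>\<^bsub>RG\<^esub> k = f \<otimes>\<^bsub>RG\<^esub> k \<oplus>\<^bsub>RG\<^esub> h \<otimes>\<^bsub>RG\<^esub> k" for f h k
  proof
    fix c show "((f \<oplus>\<^bsub>RG\<^esub> h) \<otimes>\<^bsub>RG\<^esub> k) c = (f \<otimes>\<^bsub>RG\<^esub> k \<oplus>\<^bsub>RG\<^esub> h \<otimes>\<^bsub>RG\<^esub> k) c"
      by (cases "c \<in> carrier G") (simp_all add: smash_add smash_mult smash_mult_outside distrib_right sum.distrib)
  qed
  show "k \<otimes>\<^bsub>RG\<^esub> (f \<oplus>\<^bsub>RG\<^esub> h) = k \<otimes>\<^bsub>RG\<^esub> f \<oplus>\<^bsub>RG\<^esub> k \<otimes>\<^bsub>RG\<^esub> h" for f h k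
  proof
    fix c show "(k \<otimes>\<^bsub>RG\<^esub> (f \<oplus>\<^bsub>RG\<^esub> h)) c = (k \<otimes>\<^bsub>RG\<^esub> f \<oplus>\<^bsub>RG\<^esub> k \<otimes>\<^bsub>RG\<^esub> h) c"
      by (cases "c \<in> carrier G")
        (simp_all add: smash_add smash_mult smash_mult_outside act_add distrib_left sum.distrib)
  qed
qed

text \<open>The monomial \<open>r a\<close>. Such monomials span the smash product additively, so
  additive statements need checking on them only.\<close>

definition pt :: "'g \<Rightarrow> 'r \<Rightarrow> 'g \<Rightarrow> 'r"
  where "pt a r = (\<lambda>b. if b = a then r else 0)"

lemma smash_coeff_eq_pt: "smash_coeff G r = pt \<one> r"
  by (simp add: smash_coeff_def pt_def)

lemma pt_closed: "a \<in> carrier G \<Longrightarrow> pt a r \<in> carrier RG"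
  by (auto simp: pt_def smash_carrier)

lemma pt_mult:
  assumes a: "a \<in> carrier G" and b: "b \<in> carrier G"
  shows "pt a r \<otimes>\<^bsub>RG\<^esub> pt b s = pt (a \<otimes> b) (r * act a s)"
proof
  fix c show "(pt a r \<otimes>\<^bsub>RG\<^esub> pt b s) c = pt (a \<otimes> b) (r * act a s) c"
  proof (cases "c \<in> carrier G")
    case True
    have "(pt a r \<otimes>\<^bsub>RG\<^esub> pt b s) c = (\<Sum>d\<in>carrier G. if d = a then r * act a (pt b s (inv a \<otimes> c)) else 0)"
      unfolding smash_mult[OF True] by (intro sum.cong) (auto simp: pt_def)
    also have "\<dots> = r * act a (pt b s (inv a \<otimes> c))"
      using a finite_carrier by simp
    also have "\<dots> = pt (a \<otimes> b) (r * act a s) c"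
    proof -
      have "inv a \<otimes> c = b \<longleftrightarrow> c = a \<otimes> b" using a b True by (metis inv_solve_left)
      then show ?thesis using a by (simp add: pt_def act_0)
    qed
    finally show ?thesis .
  qed (use a b in \<open>auto simp: smash_mult_outside pt_def\<close>)
qed

lemma pt_add: "pt a r \<oplus>\<^bsub>RG\<^esub> pt a s = pt a (r + s)"
  by (auto simp: pt_def smash_add fun_eq_iff)

lemma smash_finsum:
  assumes "finite I" "\<And>i. i \<in> I \<Longrightarrow> F i \<in> carrier RG"
  shows "(\<Oplus>\<^bsub>RG\<^esub>i\<in>I. F i) a = (\<Sum>i\<in>I. F i a)"
proof -
  interpret RG: ring RG by (rule smash_ring)
  show ?thesis using assms
    by (induction I) (simp_all add: smash_zero smash_add RG.finsum_insert Pi_iff)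
qed

lemma smash_eq_finsum_pt:
  assumes "f \<in> carrier RG"
  shows "f = (\<Oplus>\<^bsub>RG\<^esub>a\<in>carrier G. pt a (f a))"
proof
  fix c show "f c = (\<Oplus>\<^bsub>RG\<^esub>a\<in>carrier G. pt a (f a)) c"
    using assms finite_carrier by (subst smash_finsum) (auto simp: pt_closed pt_def smash_carrier)
qed

lemma smash_induct [consumes 1, case_names pt add]:
  assumes f: "f \<in> carrier RG"
    and pt: "\<And>a r. a \<in> carrier G \<Longrightarrow> Q (pt a r)"
    and add: "\<And>f h. \<lbrakk>f \<in> carrier RG; h \<in> carrier RG; Q f; Q h\<rbrakk> \<Longrightarrow> Q (f \<oplus>\<^bsub>RG\<^esub> h)"
  shows "Q f"
proof -
  interpret RG: ring RG by (rule smash_ring)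
  have "pt \<one> 0 = \<zero>\<^bsub>RG\<^esub>" by (auto simp: pt_def smash_zero fun_eq_iff)
  then have zero: "Q \<zero>\<^bsub>RG\<^esub>" using pt[of \<one> 0] by simp
  have "Q (\<Oplus>\<^bsub>RG\<^esub>a\<in>I. pt a (f a))" if "finite I" "I \<subseteq> carrier G" for I
    using that
  proof induction
    case (insert a I)
    then have "(\<lambda>a. pt a (f a)) \<in> I \<rightarrow> carrier RG" by (auto intro!: pt_closed)
    then show ?case using insert pt_closed pt add by (simp add: RG.finsum_insert)
  qed (simp add: zero)
  then show ?thesis using smash_eq_finsum_pt[OF f] finite_carrier by (metis subset_refl)
qed

end

section \<open>Additive endomorphisms, a ring type in which \<open>alg_eval\<close> and
  \<open>smash_hom\<close> can take values\<close>

typedef (overloaded) 'a endo = "{f :: 'a::ab_group_add \<Rightarrow> 'a. \<forall>x y. f (x + y) = f x + f y}"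
  morphisms ap Endo
  by (rule exI[of _ "\<lambda>x. x"]) simp

setup_lifting type_definition_endo

lemma ap_add: "ap f (x + y) = ap f x + ap f y"
  using ap[of f] by simp

lemma ap_zero [simp]: "ap f 0 = 0"
  using ap_add[of f 0 0] by simp

instantiation endo :: (comm_ring_1) ring_1
begin

lift_definition zero_endo :: "'a endo" is "\<lambda>_. 0" by simp
lift_definition one_endo :: "'a endo" is "\<lambda>x. x" by simp
lift_definition plus_endo :: "'a endo \<Rightarrow> 'a endo \<Rightarrow> 'a endo" is "\<lambda>f g x. f x + g x" by simp
lift_definition uminus_endo :: "'a endo \<Rightarrow> 'a endo" is "\<lambda>f x. - f x" by simp
lift_definition minus_endo :: "'a endo \<Rightarrow> 'a endo \<Rightarrow> 'a endo" is "\<lambda>f g x. f x - g x" by simp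
lift_definition times_endo :: "'a endo \<Rightarrow> 'a endo \<Rightarrow> 'a endo" is "\<lambda>f g x. f (g x)" by simp

instance
proof
  \<comment> \<open>The class \<open>ring_1\<close> requires this, so the underlying group must be
    nontrivial; the sort \<open>comm_ring_1\<close> guarantees it.\<close>
  show "(0 :: 'a endo) \<noteq> 1"
    by transfer (metis zero_neq_one)
qed (transfer; simp add: fun_eq_iff)+

end

lemma endo_eqI: "(\<And>x. ap f x = ap g x) \<Longrightarrow> f = g"
  by (simp add: ap_inject[symmetric] fun_eq_iff)

lemmas ap_endo_simps [simp] =
  zero_endo.rep_eq one_endo.rep_eq plus_endo.rep_eq uminus_endo.rep_eq minus_endo.rep_eq times_endo.rep_eq

text \<open>A covariant pair: \<open>\<rho>\<close> represents the ring, \<open>\<gamma>\<close> the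
  group, and \<open>covariant\<close> makes \<open>\<gamma>\<close> implement the action. Such a
  pair extends to a homomorphism on the smash product, namely \<open>ext\<close>.\<close>

locale smash_hom = smash_product G act
  for G :: "('g, 'n) monoid_scheme" (structure) and act :: "'g \<Rightarrow> 'r \<Rightarrow> 'r::ring_1" +
  fixes \<rho> :: "'r \<Rightarrow> 'e::ring_1" and \<gamma> :: "'g \<Rightarrow> 'e"
  assumes \<rho>_add: "\<rho> (r + s) = \<rho> r + \<rho> s"
    and \<rho>_mult: "\<rho> (r * s) = \<rho> r * \<rho> s"
    and \<rho>_one [simp]: "\<rho> 1 = 1"
    and \<gamma>_mult: "\<lbrakk>a \<in> carrier G; b \<in> carrier G\<rbrakk> \<Longrightarrow> \<gamma> (a \<otimes> b) = \<gamma> a * \<gamma> b"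
    and \<gamma>_one [simp]: "\<gamma> \<one> = 1"
    and covariant: "a \<in> carrier G \<Longrightarrow> \<gamma> a * \<rho> r = \<rho> (act a r) * \<gamma> a"
begin

definition ext :: "('g \<Rightarrow> 'r) \<Rightarrow> 'e"
  where "ext f = (\<Sum>a\<in>carrier G. \<rho> (f a) * \<gamma> a)"

lemma \<rho>_zero [simp]: "\<rho> 0 = 0"
  using \<rho>_add[of 0 0] by simp

lemma ext_add: "ext (f \<oplus>\<^bsub>RG\<^esub> h) = ext f + ext h"
  by (simp add: ext_def smash_add \<rho>_add distrib_right sum.distrib)

lemma ext_pt: "a \<in> carrier G \<Longrightarrow> ext (pt a r) = \<rho> r * \<gamma> a"
  using finite_carrier
  by (simp add: ext_def pt_def if_distrib[of \<rho>] if_distrib[of "\<lambda>x. x * _"] cong: if_cong)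

lemma ext_zero: "ext \<zero>\<^bsub>RG\<^esub> = 0"
  by (simp add: ext_def smash_zero)

lemma ext_mult:
  assumes "f \<in> carrier RG" "h \<in> carrier RG"
  shows "ext (f \<otimes>\<^bsub>RG\<^esub> h) = ext f * ext h"
proof -
  interpret RG: ring RG by (rule smash_ring)
  show ?thesis using assms(1)
  proof (induction f rule: smash_induct)
    case (pt a r)
    show ?case using assms(2)
    proof (induction h rule: smash_induct)
      case (pt b s)
      have "\<gamma> a * (\<rho> s * \<gamma> b) = \<rho> (act a s) * (\<gamma> a * \<gamma> b)"
        using covariant[of a s] \<open>a \<in> carrier G\<close> by (metis mult.assoc)
      then show ?case
        using \<open>a \<in> carrier G\<close> pt by (simp add: pt_mult ext_pt \<rho>_mult \<gamma>_mult mult.assoc)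
    qed (use \<open>a \<in> carrier G\<close> in \<open>simp add: RG.r_distr pt_closed ext_add distrib_left\<close>)
  qed (use assms(2) in \<open>simp add: RG.l_distr ext_add distrib_right\<close>)
qed

lemma ext_one: "ext \<one>\<^bsub>RG\<^esub> = 1"
proof -
  have "\<one>\<^bsub>RG\<^esub> = pt \<one> 1" by (auto simp: smash_one pt_def)
  then show ?thesis by (simp add: ext_pt)
qed

lemma ext_minus: "f \<in> carrier RG \<Longrightarrow> ext (\<ominus>\<^bsub>RG\<^esub> f) = - ext f"
proof -
  assume f: "f \<in> carrier RG"
  interpret RG: ring RG by (rule smash_ring)
  have "ext (\<ominus>\<^bsub>RG\<^esub> f) + ext f = 0"
    using f by (simp add: RG.l_neg ext_zero flip: ext_add)
  then show ?thesis by (simp add: eq_neg_iff_add_eq_0)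
qed

lemma ext_pow: "f \<in> carrier RG \<Longrightarrow> ext (f [^]\<^bsub>RG\<^esub> (n::nat)) = ext f ^ n"
proof -
  assume f: "f \<in> carrier RG"
  interpret RG: ring RG by (rule smash_ring)
  show ?thesis
    using f by (induction n) (simp_all add: ext_one ext_mult power_commutes)
qed

lemma kernel_ideal: "ideal {f \<in> carrier RG. ext f = 0} RG"
proof -
  interpret RG: ring RG by (rule smash_ring)
  have "additive_subgroup {f \<in> carrier RG. ext f = 0} RG"
  proof (rule additive_subgroup.intro, rule RG.add.subgroupI)
    show "{f \<in> carrier RG. ext f = 0} \<noteq> {}"
      using ext_zero RG.zero_closed by blast
    show "\<ominus>\<^bsub>RG\<^esub> f \<in> {f \<in> carrier RG. ext f = 0}" if "f \<in> {f \<in> carrier RG. ext f = 0}" for f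
      using that ext_minus[of f] RG.a_inv_closed[of f] by (simp add: a_inv_def)
  qed (auto simp: ext_add)
  then show ?thesis
    by (intro idealI smash_ring additive_subgroup.a_subgroup) (auto simp: ext_mult)
qed

end

section \<open>The Ore extension\<close>

text \<open>The group algebra over \<open>k[x]\<close> of the whole additive group of \<open>k\<close>, of which \<open>A\<close> is the part
  supported on the prime field; \<open>t\<close> stands for the matrix \<open>unip t\<close>.\<close>

type_synonym 'k gr = "'k \<Rightarrow>\<^sub>0 'k poly"

lift_definition gr_dx :: "'k::field gr \<Rightarrow> 'k gr" is "\<lambda>a t. pderiv (a t)"
  by (erule finite_subset[rotated]) auto

text \<open>The component at \<open>t\<close> is given weight \<open>t\<close>. Weights add under
  multiplication in the group, so this is a derivation; it accounts for the commutator of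
  \<open>y\<close> with group elements.\<close>

lift_definition gr_theta :: "'k::field gr \<Rightarrow> 'k gr" is "\<lambda>a t. Polynomial.smult t (a t)"
  by (erule finite_subset[rotated]) auto

lemma gr_dx_add: "gr_dx (a + b) = gr_dx a + gr_dx b"
  by (rule poly_mapping_eqI) (simp add: gr_dx.rep_eq lookup_add pderiv_add)

lemma gr_theta_add: "gr_theta (a + b) = gr_theta a + gr_theta b"
  by (rule poly_mapping_eqI) (simp add: gr_theta.rep_eq lookup_add smult_add_right)

lemma gr_dx_single: "gr_dx (Poly_Mapping.single t f) = Poly_Mapping.single t (pderiv f)"
  by (rule poly_mapping_eqI) (simp add: gr_dx.rep_eq lookup_single when_def)

lemma gr_theta_single: "gr_theta (Poly_Mapping.single t f) = Poly_Mapping.single t (Polynomial.smult t f)"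
  by (rule poly_mapping_eqI) (simp add: gr_theta.rep_eq lookup_single when_def)

lemma gr_dx_mult: "gr_dx (a * b) = gr_dx a * b + a * gr_dx b"
proof (induction a rule: poly_mapping_single_induct)
  case (single s f)
  show ?case
    by (induction b rule: poly_mapping_single_induct)
      (simp_all add: gr_dx_single gr_dx_add mult_single pderiv_mult algebra_simps flip: single_add)
qed (simp add: gr_dx_add algebra_simps)

lemma gr_theta_mult: "gr_theta (a * b) = gr_theta a * b + a * gr_theta b"
proof (induction a rule: poly_mapping_single_induct)
  case (single s f)
  show ?case
    by (induction b rule: poly_mapping_single_induct)
      (simp_all add: gr_theta_single gr_theta_add mult_single smult_add_left algebra_simps flip: single_add)
qed (simp add: gr_theta_add algebra_simps)

definition gr_const :: "'k::field \<Rightarrow> 'k gr"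
  where "gr_const c = Poly_Mapping.single 0 [:c:]"

definition gr_x :: "'k::field gr"
  where "gr_x = Poly_Mapping.single 0 [:0, 1:]"

definition gr_pt :: "'k::field \<Rightarrow> 'k gr"
  where "gr_pt t = Poly_Mapping.single t 1"

definition gr_lam :: "'k set \<Rightarrow> ('k::field \<Rightarrow> 'k) \<Rightarrow> 'k gr"
  where "gr_lam F l = (\<Sum>t\<in>F. gr_const (l t) * gr_pt t)"

text \<open>The commutator with \<open>y\<close>, where \<open>[x, y] = L\<close> and \<open>[g\<^sub>t, y] = t x g\<^sub>t\<close>.\<close>

definition gr_der :: "'k::field gr \<Rightarrow> 'k gr \<Rightarrow> 'k gr"
  where "gr_der L a = L * gr_dx a + gr_x * gr_theta a"

lemma gr_der_add: "gr_der L (a + b) = gr_der L a + gr_der L b"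
  by (simp add: gr_der_def gr_dx_add gr_theta_add algebra_simps)

lemma gr_der_zero [simp]: "gr_der L 0 = 0"
  using gr_der_add[of L 0 0] by simp

text \<open>A combination of derivations with coefficients in a commutative ring is again a
  derivation.\<close>

lemma gr_der_mult: "gr_der L (a * b) = gr_der L a * b + a * gr_der L b"
  by (simp add: gr_der_def gr_dx_mult gr_theta_mult algebra_simps)

lemma gr_der_const [simp]: "gr_der L (gr_const c) = 0"
  by (simp add: gr_der_def gr_const_def gr_dx_single gr_theta_single)

lemma gr_der_x [simp]: "gr_der L gr_x = L"
  by (simp add: gr_der_def gr_x_def gr_dx_single gr_theta_single pderiv_pCons flip: one_pCons)

lemma gr_der_pt: "gr_der L (gr_pt t) = gr_const t * gr_x * gr_pt t"
  by (simp add: gr_der_def gr_x_def gr_const_def gr_pt_def gr_dx_single gr_theta_single mult_single)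

text \<open>Left multiplication by \<open>y\<close> on polynomials in \<open>y\<close> with left coefficients, as \<open>y a = a y - [a, y]\<close>.\<close>

definition ore_y :: "'k::field gr \<Rightarrow> 'k gr poly \<Rightarrow> 'k gr poly"
  where "ore_y L m = pCons 0 m - map_poly (gr_der L) m"

lemma ore_y_add: "ore_y L (m + n) = ore_y L m + ore_y L n"
  by (rule poly_eqI) (simp add: ore_y_def coeff_map_poly gr_der_add coeff_pCons split: nat.split)

text \<open>The rule \<open>y a = a y - [a, y]\<close> on all of the Ore extension, by the Leibniz
  rule for \<open>gr_der\<close>. Every relation that involves the operator of \<open>y\<close>
  follows from it.\<close>

lemma ore_y_smult: "ore_y L (Polynomial.smult a m) = Polynomial.smult a (ore_y L m) - Polynomial.smult (gr_der L a) m"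
  by (rule poly_eqI)
    (simp add: ore_y_def coeff_map_poly gr_der_mult coeff_pCons algebra_simps split: nat.split)

text \<open>With \<open>pCons a m\<close> read as \<open>a + m y\<close>, this is
  \<open>y (a + m y) = - [a, y] + (a + y m) y\<close>, the recursion along which \<Phi> is compared
  with multiplication by \<open>Y\<close>.\<close>

lemma ore_y_pCons: "ore_y L (pCons a m) = pCons (- gr_der L a) ([:a:] + ore_y L m)"
  by (rule poly_eqI)
    (simp add: ore_y_def coeff_map_poly coeff_pCons split: nat.split)

lemma gr_const_simps:
  "gr_const (a + b) = gr_const a + gr_const b" "gr_const (a * b) = gr_const a * gr_const b"
  "gr_const 1 = 1" "gr_const 0 = 0"
  by (simp_all add: gr_const_def mult_single mult.commute flip: single_add one_pCons)

lemma gr_pt_add: "gr_pt (s + t) = gr_pt s * gr_pt t"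
  by (simp add: gr_pt_def mult_single)

lemma gr_pt_0: "gr_pt 0 = 1"
  by (simp add: gr_pt_def)

text \<open>The relations of \<open>H_alg lam\<close> in an arbitrary ring, with group elements
  \<open>\<delta> t\<close> indexed by a finite additive subgroup \<open>F\<close> of the field.
  Arguing from the relations alone keeps cosets out of the computations.\<close>

locale ore_relations = ring H for H (structure) +
  fixes sc :: "'k::field \<Rightarrow> 'h" and X Y :: 'h and \<delta> :: "'k \<Rightarrow> 'h" and F :: "'k set" and l :: "'k \<Rightarrow> 'k"
  assumes sc_closed [simp, intro]: "sc c \<in> carrier H"
    and X_closed [simp, intro]: "X \<in> carrier H"
    and Y_closed [simp, intro]: "Y \<in> carrier H"
    and \<delta>_closed [simp, intro]: "t \<in> F \<Longrightarrow> \<delta> t \<in> carrier H"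
    and sc_add: "sc (a + b) = sc a \<oplus> sc b"
    and sc_mult: "sc (a * b) = sc a \<otimes> sc b"
    and sc_one: "sc 1 = \<one>"
    and sc_comm: "h \<in> carrier H \<Longrightarrow> h \<otimes> sc c = sc c \<otimes> h"
    and F_finite: "finite F"
    and F_zero: "0 \<in> F"
    and F_add: "\<lbrakk>s \<in> F; t \<in> F\<rbrakk> \<Longrightarrow> s + t \<in> F"
    and F_minus: "t \<in> F \<Longrightarrow> - t \<in> F"
    and \<delta>_add: "\<lbrakk>s \<in> F; t \<in> F\<rbrakk> \<Longrightarrow> \<delta> (s + t) = \<delta> s \<otimes> \<delta> t"
    and \<delta>_zero: "\<delta> 0 = \<one>"
    and \<delta>_X: "t \<in> F \<Longrightarrow> \<delta> t \<otimes> X = X \<otimes> \<delta> t"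
    and \<delta>_Y: "t \<in> F \<Longrightarrow> \<delta> t \<otimes> Y = Y \<otimes> \<delta> t \<oplus> sc t \<otimes> X \<otimes> \<delta> t"
    and X_Y: "X \<otimes> Y = Y \<otimes> X \<oplus> (\<Oplus>t\<in>F. sc (l t) \<otimes> \<delta> t)"
begin

definition \<Lambda> where "\<Lambda> = (\<Oplus>t\<in>F. sc (l t) \<otimes> \<delta> t)"

lemma \<Lambda>_closed [simp, intro]: "\<Lambda> \<in> carrier H"
  unfolding \<Lambda>_def by (rule finsum_closed) auto

lemma sc_zero: "sc 0 = \<zero>"
  using sc_add[of 0 0] sc_closed[of 0] by (metis add.l_cancel_one' add_0)

lemma minus_if_sum: "\<lbrakk>a \<in> carrier H; b \<in> carrier H; c = a \<oplus> b\<rbrakk> \<Longrightarrow> a = c \<ominus> b"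
  by (simp add: minus_eq a_assoc r_neg)

lemma Y_X: "Y \<otimes> X = X \<otimes> Y \<ominus> \<Lambda>"
  using X_Y by (intro minus_if_sum) (auto simp: \<Lambda>_def[symmetric])

lemma Y_\<delta>: "t \<in> F \<Longrightarrow> Y \<otimes> \<delta> t = \<delta> t \<otimes> Y \<ominus> sc t \<otimes> X \<otimes> \<delta> t"
  using \<delta>_Y by (intro minus_if_sum) auto

text \<open>The group fixes \<open>x\<close>, so \<open>X\<close> commutes with every
  \<open>\<delta> t\<close>. This lets the commutator of a power of \<open>X\<close> with
  \<open>Y\<close> collapse to a derivative.\<close>

lemma X_\<Lambda>: "X \<otimes> \<Lambda> = \<Lambda> \<otimes> X"
proof -
  have "X \<otimes> (sc (l t) \<otimes> \<delta> t) = sc (l t) \<otimes> \<delta> t \<otimes> X" if "t \<in> F" for t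
    using that sc_comm[of X "l t"] by (simp add: m_assoc \<delta>_X flip: m_assoc[of X "sc (l t)"])
  then have "(\<Oplus>t\<in>F. X \<otimes> (sc (l t) \<otimes> \<delta> t)) = (\<Oplus>t\<in>F. sc (l t) \<otimes> \<delta> t \<otimes> X)"
    by (intro finsum_cong') auto
  then show ?thesis
    unfolding \<Lambda>_def by (subst finsum_rdistr finsum_ldistr, auto simp: F_finite Pi_iff)+
qed

section \<open>Moving \<open>Y\<close> past polynomials in \<open>X\<close> and past group
  elements\<close>

definition pol :: "'k poly \<Rightarrow> 'h"
  where "pol f = fold_coeffs (\<lambda>c h. sc c \<oplus> X \<otimes> h) f \<zero>"

lemma pol_0 [simp]: "pol 0 = \<zero>"
  by (simp add: pol_def)

lemma pol_pCons: "pol (pCons c f) = sc c \<oplus> X \<otimes> pol f"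
  by (cases "c = 0 \<and> f = 0") (auto simp: pol_def sc_zero)

lemma pol_closed [simp, intro]: "pol f \<in> carrier H"
  by (induction f) (auto simp: pol_pCons)

lemma pol_add: "pol (f + g) = pol f \<oplus> pol g"
  by (induction f g rule: poly_induct2)
    (auto simp: pol_pCons sc_add r_distr a_ac)

lemma pol_smult: "pol (Polynomial.smult c f) = sc c \<otimes> pol f"
proof (induction f)
  case (pCons a f)
  have "X \<otimes> (sc c \<otimes> pol f) = sc c \<otimes> (X \<otimes> pol f)"
    by (simp add: sc_comm flip: m_assoc)
  then show ?case using pCons by (simp add: pol_pCons sc_mult r_distr)
qed simp

lemma pol_mult: "pol (f * g) = pol f \<otimes> pol g"
  by (induction f) (auto simp: pol_pCons pol_add pol_smult sc_zero l_distr m_assoc)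

lemma pol_monom: "pol (monom 1 n) = X [^] n"
proof (induction n)
  case (Suc n)
  then have "pol (monom 1 (Suc n)) = X \<otimes> X [^] n" by (simp add: monom_Suc pol_pCons sc_zero)
  then show ?case by (metis nat_pow_Suc2 X_closed)
qed (simp add: pol_pCons monom_0 sc_one)

lemma \<delta>_pol: "t \<in> F \<Longrightarrow> \<delta> t \<otimes> pol f = pol f \<otimes> \<delta> t"
proof (induction f)
  case (pCons c f)
  then have "\<delta> t \<otimes> (X \<otimes> pol f) = X \<otimes> (pol f \<otimes> \<delta> t)"
    by (simp add: \<delta>_X m_assoc flip: m_assoc[of "\<delta> t" X])
  then show ?case using pCons by (simp add: pol_pCons l_distr r_distr sc_comm m_assoc)
qed simp

lemma X_pol: "X \<otimes> pol f = pol f \<otimes> X"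
  using pol_mult[of "[:0,1:]" f] pol_mult[of f "[:0,1:]"]
  by (simp add: pol_pCons sc_zero sc_one mult.commute)

text \<open>The commutator of \<open>X\<close> and \<open>Y\<close> is \<Lambda>, which commutes
  with \<open>X\<close>; so the commutator with \<open>Y\<close> acts on polynomials in
  \<open>X\<close> as \<Lambda> times the derivative. The induction is the Leibniz rule for
  \<open>c + x f\<close>.\<close>

lemma Y_pol: "Y \<otimes> pol f = pol f \<otimes> Y \<ominus> \<Lambda> \<otimes> pol (pderiv f)"
proof (induction f)
  case (pCons c f)
  have "Y \<otimes> pol (pCons c f) = sc c \<otimes> Y \<oplus> Y \<otimes> X \<otimes> pol f"
    by (simp add: pol_pCons r_distr sc_comm m_assoc)
  also have "\<dots> = sc c \<otimes> Y \<oplus> (X \<otimes> (Y \<otimes> pol f) \<ominus> \<Lambda> \<otimes> pol f)"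
    by (simp add: Y_X minus_eq l_distr l_minus m_assoc)
  also have "\<dots> = sc c \<otimes> Y \<oplus> (X \<otimes> (pol f \<otimes> Y) \<ominus> X \<otimes> \<Lambda> \<otimes> pol (pderiv f) \<ominus> \<Lambda> \<otimes> pol f)"
    by (simp add: pCons minus_eq r_distr r_minus m_assoc)
  also have "\<dots> = pol (pCons c f) \<otimes> Y \<ominus> \<Lambda> \<otimes> pol (pderiv (pCons c f))"
    unfolding X_\<Lambda>
    by (simp add: pderiv_pCons pol_pCons pol_add sc_zero minus_eq l_distr r_distr minus_add a_ac m_assoc)
  finally show ?case .
qed (simp add: minus_eq)

definition \<Phi>A :: "'k gr \<Rightarrow> 'h"
  where "\<Phi>A a = (\<Oplus>t\<in>F. pol (Poly_Mapping.lookup a t) \<otimes> \<delta> t)"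

lemma \<Phi>A_closed [simp, intro]: "\<Phi>A a \<in> carrier H"
  unfolding \<Phi>A_def by (rule finsum_closed) auto

lemma \<Phi>A_add: "\<Phi>A (a + b) = \<Phi>A a \<oplus> \<Phi>A b"
proof -
  have "\<Phi>A (a + b) = (\<Oplus>t\<in>F. pol (Poly_Mapping.lookup a t) \<otimes> \<delta> t \<oplus> pol (Poly_Mapping.lookup b t) \<otimes> \<delta> t)"
    unfolding \<Phi>A_def by (intro finsum_cong') (auto simp: lookup_add pol_add l_distr)
  then show ?thesis unfolding \<Phi>A_def by (simp add: finsum_addf Pi_iff)
qed

lemma \<Phi>A_0 [simp]: "\<Phi>A 0 = \<zero>"
proof -
  have "\<Phi>A 0 = (\<Oplus>t\<in>F. \<zero>)" unfolding \<Phi>A_def by (intro finsum_cong') auto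
  then show ?thesis by simp
qed

lemma \<Phi>A_uminus: "\<Phi>A (- a) = \<ominus> \<Phi>A a"
  using \<Phi>A_add[of "- a" a] minus_equality[of "\<Phi>A (- a)" "\<Phi>A a"] by simp

lemma \<Phi>A_single: "\<Phi>A (Poly_Mapping.single s f) = (if s \<in> F then pol f \<otimes> \<delta> s else \<zero>)"
proof -
  have "\<Phi>A (Poly_Mapping.single s f) = (\<Oplus>t\<in>F. if s = t then pol f \<otimes> \<delta> t else \<zero>)"
    unfolding \<Phi>A_def by (intro finsum_cong') (auto simp: lookup_single)
  also have "\<dots> = (if s \<in> F then pol f \<otimes> \<delta> s else \<zero>)"
  proof (cases "s \<in> F")
    case True
    then show ?thesis using finsum_singleton[OF True F_finite, of "\<lambda>t. pol f \<otimes> \<delta> t"] by auto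
  next
    case False
    have "(\<Oplus>t\<in>F. if s = t then pol f \<otimes> \<delta> t else \<zero>) = (\<Oplus>t\<in>F. \<zero>)"
      using False by (intro finsum_cong') auto
    then show ?thesis using False by simp
  qed
  finally show ?thesis .
qed

lemma \<Phi>A_single_mult:
  assumes s: "s \<in> F"
  shows "\<Phi>A (Poly_Mapping.single s f * a) = pol f \<otimes> \<delta> s \<otimes> \<Phi>A a"
proof (induction a rule: poly_mapping_single_induct)
  case (single t g)
  \<comment> \<open>Since \<open>F\<close> is a subgroup, translation by \<open>s\<close> respects
    membership in it: components that \<open>\<Phi>A\<close> discards stay discarded.\<close>
  have "s + t \<in> F \<longleftrightarrow> t \<in> F"
    using F_add[OF F_minus[OF s], of "s + t"] F_add[OF s, of t] by auto
  moreover have "pol f \<otimes> pol g \<otimes> (\<delta> s \<otimes> \<delta> t) = pol f \<otimes> \<delta> s \<otimes> (pol g \<otimes> \<delta> t)" if "t \<in> F"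
  proof -
    have "pol f \<otimes> \<delta> s \<otimes> (pol g \<otimes> \<delta> t) = pol f \<otimes> (\<delta> s \<otimes> pol g) \<otimes> \<delta> t"
      using s that by (simp add: m_assoc)
    then show ?thesis using s that by (simp add: \<delta>_pol m_assoc)
  qed
  ultimately show ?case
    using s by (simp add: mult_single \<Phi>A_single pol_mult \<delta>_add)
qed (use s in \<open>simp add: distrib_left \<Phi>A_add r_distr\<close>)

lemma \<Phi>A_const_mult: "\<Phi>A (gr_const c * a) = sc c \<otimes> \<Phi>A a"
  using F_zero by (simp add: gr_const_def \<Phi>A_single_mult pol_pCons \<delta>_zero)

lemma \<Phi>A_x_mult: "\<Phi>A (gr_x * a) = X \<otimes> \<Phi>A a"
  using F_zero by (simp add: gr_x_def \<Phi>A_single_mult pol_pCons \<delta>_zero sc_zero sc_one)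

lemma \<Phi>A_pt_mult: "s \<in> F \<Longrightarrow> \<Phi>A (gr_pt s * a) = \<delta> s \<otimes> \<Phi>A a"
  by (simp add: gr_pt_def \<Phi>A_single_mult one_pCons pol_pCons sc_one)

lemma \<Phi>A_lam_mult: "\<Phi>A (gr_lam F l * a) = \<Lambda> \<otimes> \<Phi>A a"
proof -
  have "\<Phi>A (gr_lam I l * a) = (\<Oplus>t\<in>I. sc (l t) \<otimes> \<delta> t) \<otimes> \<Phi>A a" if "finite I" "I \<subseteq> F" for I
    using that
  proof induction
    case (insert t I)
    then have "gr_lam (insert t I) l * a = gr_const (l t) * (gr_pt t * a) + gr_lam I l * a"
      by (simp add: gr_lam_def algebra_simps)
    moreover have "(\<lambda>t. sc (l t) \<otimes> \<delta> t) \<in> I \<rightarrow> carrier H" using insert by auto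
    ultimately show ?case
      using insert by (simp add: \<Phi>A_add \<Phi>A_const_mult \<Phi>A_pt_mult finsum_insert l_distr m_assoc)
  qed (simp add: gr_lam_def)
  then show ?thesis using F_finite unfolding \<Lambda>_def by blast
qed

abbreviation D where "D \<equiv> gr_der (gr_lam F l)"

text \<open>The formal commutator \<open>gr_der\<close> agrees with the one in \<open>H\<close>:
  moving \<open>Y\<close> past \<open>pol f\<close> yields the term with the derivative, moving it
  past \<open>\<delta> t\<close> the term with weight \<open>t\<close>.\<close>

lemma Y_\<Phi>A: "Y \<otimes> \<Phi>A a = \<Phi>A a \<otimes> Y \<ominus> \<Phi>A (D a)"
proof (induction a rule: poly_mapping_single_induct)
  case (single t f)
  have D: "\<Phi>A (D (Poly_Mapping.single t f)) = \<Lambda> \<otimes> \<Phi>A (Poly_Mapping.single t (pderiv f))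
      \<oplus> X \<otimes> \<Phi>A (Poly_Mapping.single t (Polynomial.smult t f))"
    by (simp add: gr_der_def gr_dx_single gr_theta_single \<Phi>A_add \<Phi>A_x_mult \<Phi>A_lam_mult)
  show ?case
  proof (cases "t \<in> F")
    case True
    have "Y \<otimes> (pol f \<otimes> \<delta> t) = pol f \<otimes> (Y \<otimes> \<delta> t) \<ominus> \<Lambda> \<otimes> pol (pderiv f) \<otimes> \<delta> t"
      using True by (simp add: Y_pol minus_eq l_distr l_minus m_assoc flip: m_assoc[of Y])
    also have "\<dots> = pol f \<otimes> \<delta> t \<otimes> Y \<ominus> pol f \<otimes> sc t \<otimes> X \<otimes> \<delta> t \<ominus> \<Lambda> \<otimes> pol (pderiv f) \<otimes> \<delta> t"
      using True by (simp add: Y_\<delta> minus_eq r_distr r_minus m_assoc)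
    also have "pol f \<otimes> sc t \<otimes> X \<otimes> \<delta> t = X \<otimes> pol (Polynomial.smult t f) \<otimes> \<delta> t"
      by (simp add: X_pol[of "Polynomial.smult t f"]) (simp add: pol_smult sc_comm)
    finally show ?thesis
      using True by (simp add: D \<Phi>A_single minus_eq minus_add a_ac m_assoc)
  qed (simp add: D \<Phi>A_single minus_eq)
qed (simp add: \<Phi>A_add gr_der_add r_distr l_distr minus_eq minus_add a_ac)

text \<open>Substitution of the generators of \<open>H\<close> into elements of the Ore extension; components
  of the coefficients outside \<open>F\<close> are discarded.\<close>

definition \<Phi> :: "'k gr poly \<Rightarrow> 'h"
  where "\<Phi> m = fold_coeffs (\<lambda>a h. \<Phi>A a \<oplus> h \<otimes> Y) m \<zero>"

lemma \<Phi>_0 [simp]: "\<Phi> 0 = \<zero>"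
  by (simp add: \<Phi>_def)

lemma \<Phi>_pCons: "\<Phi> (pCons a m) = \<Phi>A a \<oplus> \<Phi> m \<otimes> Y"
  by (cases "a = 0 \<and> m = 0") (auto simp: \<Phi>_def)

lemma \<Phi>_closed [simp, intro]: "\<Phi> m \<in> carrier H"
  by (induction m) (auto simp: \<Phi>_pCons)

lemma \<Phi>_add: "\<Phi> (m + n) = \<Phi> m \<oplus> \<Phi> n"
  by (induction m n rule: poly_induct2) (auto simp: \<Phi>_pCons \<Phi>A_add l_distr a_ac)

text \<open>\<Phi> multiplies by \<open>Y\<close> on the right only, so a left factor common to all
  coefficients can be pulled out.\<close>

lemma \<Phi>_smult:
  assumes "\<And>b. \<Phi>A (a * b) = h \<otimes> \<Phi>A b" and "h \<in> carrier H"
  shows "\<Phi> (Polynomial.smult a m) = h \<otimes> \<Phi> m"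
  by (induction m) (auto simp: \<Phi>_pCons assms r_distr m_assoc)

text \<open>\<open>ore_y\<close> is built from the commutation rule, and \<open>Y_\<Phi>A\<close>
  says that \<open>H\<close> obeys the same rule; so \<Phi> intertwines the operator with
  multiplication by \<open>Y\<close>.\<close>

lemma \<Phi>_Y: "\<Phi> (ore_y (gr_lam F l) m) = Y \<otimes> \<Phi> m"
proof (induction m)
  case 0
  then show ?case by (simp add: ore_y_def)
next
  case (pCons a m)
  then show ?case
    by (simp add: ore_y_pCons \<Phi>_pCons \<Phi>_add \<Phi>A_uminus r_distr l_distr Y_\<Phi>A minus_eq a_ac m_assoc)
qed

lemma \<Phi>_1: "\<Phi> 1 = \<one>"
  using \<Phi>A_pt_mult[OF F_zero, of 1] F_zero
  by (simp add: one_pCons \<Phi>_pCons \<Phi>A_single \<delta>_zero pol_pCons sc_one flip: single_one)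

lemma Y_X_pow_char:
  assumes "of_nat n = (0 :: 'k)"
  shows "Y \<otimes> X [^] n = X [^] n \<otimes> Y"
  using Y_pol[of "monom 1 n"] assms by (simp add: pol_monom pderiv_monom minus_eq)

end

section \<open>The algebras \<open>H\<^sub>\<lambda>\<close>\<close>

definition mul_endo :: "'a::comm_ring_1 \<Rightarrow> 'a poly endo"
  where "mul_endo a = Endo (Polynomial.smult a)"

lemma ap_mul_endo [simp]: "ap (mul_endo a) m = Polynomial.smult a m"
  by (simp add: mul_endo_def Endo_inverse smult_add_right)

definition y_endo :: "'k::field gr \<Rightarrow> 'k gr poly endo"
  where "y_endo L = Endo (ore_y L)"

lemma ap_y_endo [simp]: "ap (y_endo L) m = ore_y L m"
  by (simp add: y_endo_def Endo_inverse ore_y_add)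

lemma mul_endo_mult: "mul_endo a * mul_endo b = mul_endo (a * b)"
  by (rule endo_eqI) simp

lemma mul_endo_add: "mul_endo a + mul_endo b = mul_endo (a + b)"
  by (rule endo_eqI) (simp add: smult_add_left)

lemma mul_endo_1 [simp]: "mul_endo 1 = 1"
  by (rule endo_eqI) simp

lemma mul_endo_0 [simp]: "mul_endo 0 = 0"
  by (rule endo_eqI) simp

lemma mul_endo_power: "mul_endo a ^ n = mul_endo (a ^ n)"
  by (induction n) (simp_all add: mul_endo_mult)

lemma mul_endo_sum: "mul_endo (\<Sum>i\<in>I. f i) = (\<Sum>i\<in>I. mul_endo (f i))"
  by (induction I rule: infinite_finite_induct) (simp_all flip: mul_endo_add)

lemma mul_endo_y_endo: "mul_endo a * y_endo L = y_endo L * mul_endo a + mul_endo (gr_der L a)"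
  by (rule endo_eqI) (simp add: ore_y_smult)

definition gen_endo :: "'k::field gr \<Rightarrow> 2 \<Rightarrow> 'k gr poly endo"
  where "gen_endo L v = (if v = 1 then mul_endo gr_x else y_endo L)"

text \<open>Scalars commute with the operator of \<open>y\<close> because \<open>gr_der\<close>
  vanishes on constants.\<close>

interpretation endo_eval: alg_eval "\<lambda>c. mul_endo (gr_const c)" "gen_endo L" for L :: "'k::field gr"
proof
  show "mul_endo (gr_const c) * gen_endo L v = gen_endo L v * mul_endo (gr_const c)" for c v
    by (cases "v = 1") (simp_all add: gen_endo_def mul_endo_mult mult.commute mul_endo_y_endo)
qed (simp_all add: gr_const_simps mul_endo_mult mul_endo_add)

lemma gen_endo_simps [simp]: "gen_endo L 1 = mul_endo gr_x" "gen_endo L 2 = y_endo L"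
  by (simp_all add: gen_endo_def)

lemma mat_act_unip_gen:
  "mat_act (unip t) (gen 1) = gen 1" "mat_act (unip t) (gen 2) = scalar t * gen 1 + gen 2"
  by (simp_all add: mat_act_gen sum_2 scalar_zero scalar_one)

locale H_algebra =
  fixes lam :: "'k::field ^ 2 ^ 2 \<Rightarrow> 'k"
  assumes char_pos: "CHAR('k) > 0" and lam_in_kG: "lam \<in> kG"
begin

abbreviation F where "F \<equiv> range (of_int :: int \<Rightarrow> 'k)"
abbreviation l where "l t \<equiv> lam (unip t)"
abbreviation L where "L \<equiv> gr_lam F l"

lemma finite_F: "finite F"
  by (rule finite_range_of_int[OF char_pos])

text \<open>The entry \<open>A $ 1 $ 2\<close> recovers \<open>t\<close> from \<open>unip t\<close>.
  Covariance is additive and multiplicative in \<open>r\<close>, so scalars and generators suffice;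
  for \<open>y\<close> it is the relation \<open>g y = y g + t x g\<close>, which comes from
  \<open>gr_der_pt\<close>.\<close>

sublocale smash_hom "cyc_G :: ('k ^ 2 ^ 2) monoid" mat_act "endo_eval.ev L" "\<lambda>A. mul_endo (gr_pt (A $ 1 $ 2))"
proof (intro smash_hom.intro smash_product.intro cyc_G_group smash_product_axioms.intro smash_hom_axioms.intro)
  fix a :: "'k ^ 2 ^ 2" and r :: "(2, 'k) free_alg"
  assume "a \<in> carrier cyc_G"
  then obtain t where a: "a = unip t" by (auto simp: cyc_G_carrier)
  show "mul_endo (gr_pt (a $ 1 $ 2)) * endo_eval.ev L r
    = endo_eval.ev L (mat_act a r) * mul_endo (gr_pt (a $ 1 $ 2))"
  proof (induction r rule: free_alg_induct)
    case (scalar c)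
    then show ?case by (simp add: mat_act_scalar mul_endo_mult mult.commute)
  next
    case (gen v)
    show ?case
    proof (cases "v = 1")
      case True
      then show ?thesis by (simp add: a mat_act_unip_gen mul_endo_mult mult.commute)
    next
      case False
      then have "v = 2" using exhaust_2[of v] by simp
      then show ?thesis
        by (simp add: a mat_act_unip_gen endo_eval.ev_add endo_eval.ev_mult mul_endo_mult
            mul_endo_y_endo gr_der_pt distrib_right add.commute)
    qed
  next
    case (mult f g)
    let ?g = "mul_endo (gr_pt (a $ 1 $ 2))"
    have "?g * endo_eval.ev L (f * g) = endo_eval.ev L (mat_act a f) * (?g * endo_eval.ev L g)"
      unfolding endo_eval.ev_mult mult.assoc[symmetric] mult.IH(1) ..
    also have "\<dots> = endo_eval.ev L (mat_act a (f * g)) * ?g"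
      unfolding mult.IH(2) mat_act_mult endo_eval.ev_mult mult.assoc ..
    finally show ?case .
  qed (simp add: mat_act_add endo_eval.ev_add distrib_left distrib_right)
next
  fix a b :: "'k ^ 2 ^ 2"
  assume "a \<in> carrier cyc_G" "b \<in> carrier cyc_G"
  then show "mul_endo (gr_pt ((a \<otimes>\<^bsub>cyc_G\<^esub> b) $ 1 $ 2))
      = mul_endo (gr_pt (a $ 1 $ 2)) * mul_endo (gr_pt (b $ 1 $ 2))"
    by (auto simp: cyc_G_carrier cyc_G_mult unip_mult mul_endo_mult gr_pt_add)
next
  show "mul_endo (gr_pt (\<one>\<^bsub>cyc_G\<^esub> $ 1 $ 2)) = 1"
    by (simp add: cyc_G_one gr_pt_0 flip: unip_0)
next
  show "finite (carrier (cyc_G :: ('k ^ 2 ^ 2) monoid))"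
    unfolding cyc_G_carrier using finite_F by (rule finite_imageI)
  show "mat_act a 1 = (1 :: (2, 'k) free_alg)" for a
    using mat_act_scalar[of a 1] unfolding scalar_one .
  show "mat_act (a \<otimes>\<^bsub>cyc_G\<^esub> b) r = mat_act a (mat_act b r)" for a b and r :: "(2, 'k) free_alg"
    unfolding cyc_G_mult by (rule mat_act_matrix_mult)
  show "mat_act \<one>\<^bsub>cyc_G\<^esub> r = r" for r :: "(2, 'k) free_alg"
    unfolding cyc_G_one by (rule mat_act_one_mat)
qed (rule mat_act_add mat_act_mult endo_eval.ev_add endo_eval.ev_mult endo_eval.ev_one)+

sublocale RG: ring RG
  by (rule smash_ring)

abbreviation e where "e r \<equiv> pt \<one>\<^bsub>cyc_G\<^esub> r"
abbreviation u where "u t \<equiv> pt (unip t) (1 :: (2, 'k) free_alg)"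

lemma unip_in: "unip t \<in> carrier cyc_G \<longleftrightarrow> t \<in> F"
  by (auto simp: cyc_G_carrier)

lemma e_closed [simp, intro]: "e r \<in> carrier RG"
  by (simp add: pt_closed)

lemma u_closed [simp, intro]: "t \<in> F \<Longrightarrow> u t \<in> carrier RG"
  by (simp add: pt_closed unip_in)

lemma e_mult: "e r \<otimes>\<^bsub>RG\<^esub> e s = e (r * s)"
  by (simp add: pt_mult act_one)

lemma e_u: "t \<in> F \<Longrightarrow> e r \<otimes>\<^bsub>RG\<^esub> u t = pt (unip t) r"
  by (simp add: pt_mult unip_in act_one)

lemma u_e: "t \<in> F \<Longrightarrow> u t \<otimes>\<^bsub>RG\<^esub> e r = pt (unip t) (mat_act (unip t) r)"
  by (simp add: pt_mult unip_in)

lemma u_u: "\<lbrakk>s \<in> F; t \<in> F\<rbrakk> \<Longrightarrow> u s \<otimes>\<^bsub>RG\<^esub> u t = u (s + t)"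
  by (simp add: pt_mult unip_in act_1 cyc_G_mult unip_mult)

lemma e_1: "e 1 = \<one>\<^bsub>RG\<^esub>" and u_0: "u 0 = \<one>\<^bsub>RG\<^esub>"
  by (auto simp: fun_eq_iff pt_def smash_one cyc_G_one unip_0)

lemma RG_induct [consumes 1, case_names scalar x y u add mult]:
  assumes f: "f \<in> carrier RG"
    and scalar: "\<And>c. Q (e (scalar c))" and x: "Q (e (gen 1))" and y: "Q (e (gen 2))"
    and u: "\<And>t. t \<in> F \<Longrightarrow> Q (u t)"
    and add: "\<And>f h. \<lbrakk>f \<in> carrier RG; h \<in> carrier RG; Q f; Q h\<rbrakk> \<Longrightarrow> Q (f \<oplus>\<^bsub>RG\<^esub> h)"
    and mult: "\<And>f h. \<lbrakk>f \<in> carrier RG; h \<in> carrier RG; Q f; Q h\<rbrakk> \<Longrightarrow> Q (f \<otimes>\<^bsub>RG\<^esub> h)"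
  shows "Q f"
  using f
proof (induction f rule: smash_induct)
  case (pt a r)
  have "Q (e r)"
  proof (induction r rule: free_alg_induct)
    case (gen v)
    then show ?case using x y exhaust_2[of v] by auto
  next
    case (add r s)
    then show ?case using assms(6)[of "e r" "e s"] by (simp add: pt_add)
  next
    case (mult r s)
    then show ?case using assms(7)[of "e r" "e s"] by (simp add: e_mult)
  qed (rule scalar)
  moreover obtain t where "t \<in> F" "a = unip t" using pt by (auto simp: cyc_G_carrier)
  ultimately show ?case using mult[of "e r" "u t"] u e_u by simp
qed (rule add)

definition lam_elt :: "'k ^ 2 ^ 2 \<Rightarrow> (2, 'k) free_alg"
  where "lam_elt = (\<lambda>a. scalar (lam a))"

lemma lam_elt_closed [simp, intro]: "lam_elt \<in> carrier RG"
  using lam_in_kG by (simp add: lam_elt_def smash_carrier kG_def scalar_zero)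

text \<open>The form in which \<open>ore_relations\<close> states the commutator of \<open>X\<close>
  and \<open>Y\<close>, summed over field elements instead of matrices.\<close>

lemma lam_elt_eq: "lam_elt = (\<Oplus>\<^bsub>RG\<^esub>t\<in>F. e (scalar (l t)) \<otimes>\<^bsub>RG\<^esub> u t)"
proof
  fix a
  have "(\<Oplus>\<^bsub>RG\<^esub>t\<in>F. e (scalar (l t)) \<otimes>\<^bsub>RG\<^esub> u t) a = (\<Sum>t\<in>F. (e (scalar (l t)) \<otimes>\<^bsub>RG\<^esub> u t) a)"
    by (rule smash_finsum[OF finite_F]) auto
  also have "\<dots> = (\<Sum>t\<in>F. pt (unip t) (scalar (l t)) a)"
    by (intro sum.cong) (auto simp: e_u)
  also have "\<dots> = (\<Sum>b\<in>carrier cyc_G. pt b (scalar (lam b)) a)"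
    unfolding cyc_G_carrier by (subst sum.reindex) (auto simp: inj_on_def)
  also have "\<dots> = lam_elt a"
    using lam_elt_closed finite_carrier by (auto simp: pt_def lam_elt_def smash_carrier)
  finally show "lam_elt a = (\<Oplus>\<^bsub>RG\<^esub>t\<in>F. e (scalar (l t)) \<otimes>\<^bsub>RG\<^esub> u t) a" by simp
qed

definition rel where "rel = e (gen 1) \<otimes>\<^bsub>RG\<^esub> e (gen 2) \<ominus>\<^bsub>RG\<^esub> e (gen 2) \<otimes>\<^bsub>RG\<^esub> e (gen 1) \<ominus>\<^bsub>RG\<^esub> lam_elt"

lemma rel_closed [simp, intro]: "rel \<in> carrier RG"
  by (simp add: rel_def)

definition I where "I = Idl\<^bsub>RG\<^esub> {rel}"

lemma H_alg_eq: "H_alg lam = RG Quot I"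
  by (simp add: Let_def H_alg_def H_smash_def I_def rel_def lam_elt_def smash_coeff_eq_pt)

sublocale I: ideal I RG
  unfolding I_def by (rule RG.genideal_ideal) simp

lemma ext_e: "ext (e r) = endo_eval.ev L r"
proof -
  have "(\<one>\<^bsub>cyc_G\<^esub> :: 'k ^ 2 ^ 2) $ 1 $ 2 = 0" unfolding cyc_G_one by (simp add: mat_def)
  then show ?thesis using ext_pt[OF one_closed, of r] by (simp add: gr_pt_0)
qed

lemma ext_u: "t \<in> F \<Longrightarrow> ext (u t) = mul_endo (gr_pt t)"
  by (simp add: ext_pt unip_in)

lemma ext_lam_elt: "ext lam_elt = mul_endo L"
proof -
  have "ext lam_elt = (\<Sum>t\<in>F. mul_endo (gr_const (l t)) * mul_endo (gr_pt t))"
    unfolding ext_def cyc_G_carrier lam_elt_def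
    by (subst sum.reindex) (auto simp: inj_on_def)
  then show ?thesis
    by (simp add: gr_lam_def mul_endo_sum mul_endo_mult)
qed

text \<open>The operators of \<open>x\<close> and \<open>y\<close> have as commutator the
  multiplication by \<open>gr_der L gr_x = L\<close>, which is also the operator of
  \<open>lam_elt\<close>. So the kernel of \<open>ext\<close> is an ideal containing
  \<open>rel\<close>, and the action passes to the quotient.\<close>

lemma ext_I: "r \<in> I \<Longrightarrow> ext r = 0"
proof -
  have "mul_endo gr_x * y_endo L - y_endo L * mul_endo gr_x = mul_endo L"
    by (simp add: mul_endo_y_endo)
  then have "ext rel = 0"
    unfolding rel_def RG.minus_eq by (simp add: ext_add ext_mult ext_minus ext_e ext_lam_elt)
  then have "I \<subseteq> {f \<in> carrier RG. ext f = 0}"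
    unfolding I_def by (intro RG.genideal_minimal kernel_ideal) auto
  then show "r \<in> I \<Longrightarrow> ext r = 0" by auto
qed

section \<open>The quotient ring and its elements as values of \<Phi>\<close>

abbreviation H where "H \<equiv> RG Quot I"
abbreviation \<pi> where "\<pi> \<equiv> (+>\<^bsub>RG\<^esub>) I"

sublocale HR: ring H
  by (rule I.quotient_is_ring)

lemma \<pi>_closed [simp, intro]: "r \<in> carrier RG \<Longrightarrow> \<pi> r \<in> carrier H"
  and \<pi>_mult [simp]: "\<lbrakk>r \<in> carrier RG; s \<in> carrier RG\<rbrakk> \<Longrightarrow> \<pi> (r \<otimes>\<^bsub>RG\<^esub> s) = \<pi> r \<otimes>\<^bsub>H\<^esub> \<pi> s"
  and \<pi>_add [simp]: "\<lbrakk>r \<in> carrier RG; s \<in> carrier RG\<rbrakk> \<Longrightarrow> \<pi> (r \<oplus>\<^bsub>RG\<^esub> s) = \<pi> r \<oplus>\<^bsub>H\<^esub> \<pi> s"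
  and \<pi>_one [simp]: "\<pi> \<one>\<^bsub>RG\<^esub> = \<one>\<^bsub>H\<^esub>"
  using I.rcos_ring_hom by (auto simp: ring_hom_def)

lemma \<pi>_zero [simp]: "\<pi> \<zero>\<^bsub>RG\<^esub> = \<zero>\<^bsub>H\<^esub>"
  using \<pi>_add[of "\<zero>\<^bsub>RG\<^esub>" "\<zero>\<^bsub>RG\<^esub>"] \<pi>_closed[of "\<zero>\<^bsub>RG\<^esub>"]
  by (metis HR.add.l_cancel_one' RG.l_zero RG.zero_closed)

lemma \<pi>_minus [simp]: "r \<in> carrier RG \<Longrightarrow> \<pi> (\<ominus>\<^bsub>RG\<^esub> r) = \<ominus>\<^bsub>H\<^esub> \<pi> r"
  using \<pi>_add[of "\<ominus>\<^bsub>RG\<^esub> r" r] HR.minus_equality[of "\<pi> (\<ominus>\<^bsub>RG\<^esub> r)" "\<pi> r"]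
  by (simp add: RG.l_neg)

lemma \<pi>_pow [simp]: "r \<in> carrier RG \<Longrightarrow> \<pi> (r [^]\<^bsub>RG\<^esub> (n::nat)) = \<pi> r [^]\<^bsub>H\<^esub> n"
  by (induction n) auto

lemma \<pi>_surj: "h \<in> carrier H \<Longrightarrow> \<exists>r\<in>carrier RG. h = \<pi> r"
  unfolding FactRing_def A_RCOSETS_def' by simp

lemma \<pi>_eq_iff: "\<lbrakk>r \<in> carrier RG; s \<in> carrier RG\<rbrakk> \<Longrightarrow> \<pi> r = \<pi> s \<longleftrightarrow> r \<ominus>\<^bsub>RG\<^esub> s \<in> I"
  by (rule RG.quotient_eq_iff_same_a_r_cos[OF I.is_ideal, symmetric])

text \<open>The group acts by maps that fix the scalars, so scalars are central already in the smash
  product.\<close>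

lemma \<pi>_scalar_central:
  assumes "h \<in> carrier H"
  shows "h \<otimes>\<^bsub>H\<^esub> \<pi> (e (scalar c)) = \<pi> (e (scalar c)) \<otimes>\<^bsub>H\<^esub> h"
proof -
  obtain r where r: "r \<in> carrier RG" "h = \<pi> r" using \<pi>_surj assms by blast
  have "r \<otimes>\<^bsub>RG\<^esub> e (scalar c) = e (scalar c) \<otimes>\<^bsub>RG\<^esub> r"
    using r(1)
  proof (induction r rule: smash_induct)
    case (pt a r)
    then show ?case by (simp add: pt_mult mat_act_scalar act_one scalar_comm)
  qed (simp add: RG.l_distr RG.r_distr)
  then show ?thesis
    using r e_closed by (metis \<pi>_mult)
qed

sublocale ore: ore_relations H "\<lambda>c. \<pi> (e (scalar c))" "\<pi> (e (gen 1))" "\<pi> (e (gen 2))" "\<lambda>t. \<pi> (u t)" F l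
proof (intro ore_relations.intro ore_relations_axioms.intro)
  show "ring H" by (rule HR.ring_axioms)
  show "\<pi> (e (scalar (a + b))) = \<pi> (e (scalar a)) \<oplus>\<^bsub>H\<^esub> \<pi> (e (scalar b))" for a b
    by (simp add: scalar_add flip: pt_add)
  show "\<pi> (e (scalar (a * b))) = \<pi> (e (scalar a)) \<otimes>\<^bsub>H\<^esub> \<pi> (e (scalar b))" for a b
    by (simp add: scalar_mult flip: e_mult)
  show "\<pi> (e (scalar 1)) = \<one>\<^bsub>H\<^esub>" "\<pi> (u 0) = \<one>\<^bsub>H\<^esub>"
    by (simp_all add: scalar_one e_1 u_0)
  show "h \<otimes>\<^bsub>H\<^esub> \<pi> (e (scalar c)) = \<pi> (e (scalar c)) \<otimes>\<^bsub>H\<^esub> h" if "h \<in> carrier H" for h c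
    using that by (rule \<pi>_scalar_central)
  show "0 \<in> F" by (auto intro: range_eqI[of _ _ 0])
  show "s + t \<in> F" if "s \<in> F" "t \<in> F" for s t
    using that by (auto simp flip: of_int_add)
  show "- t \<in> F" if "t \<in> F" for t
    using that by (auto simp flip: of_int_minus)
  show "\<pi> (u (s + t)) = \<pi> (u s) \<otimes>\<^bsub>H\<^esub> \<pi> (u t)" if "s \<in> F" "t \<in> F" for s t
    using that by (simp flip: u_u)
  show "\<pi> (u t) \<otimes>\<^bsub>H\<^esub> \<pi> (e (gen 1)) = \<pi> (e (gen 1)) \<otimes>\<^bsub>H\<^esub> \<pi> (u t)" if "t \<in> F" for t
    using that by (simp add: u_e e_u mat_act_unip_gen flip: \<pi>_mult)
  show "\<pi> (u t) \<otimes>\<^bsub>H\<^esub> \<pi> (e (gen 2)) = \<pi> (e (gen 2)) \<otimes>\<^bsub>H\<^esub> \<pi> (u t)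
      \<oplus>\<^bsub>H\<^esub> \<pi> (e (scalar t)) \<otimes>\<^bsub>H\<^esub> \<pi> (e (gen 1)) \<otimes>\<^bsub>H\<^esub> \<pi> (u t)" if "t \<in> F" for t
    using that
    by (simp add: u_e e_u e_mult mat_act_unip_gen pt_add pt_closed unip_in add.commute
        flip: \<pi>_mult \<pi>_add)
  \<comment> \<open>Regrouping \<open>(a - b) - c\<close> as \<open>a - (b + c)\<close> gives the
    single difference that \<open>\<pi>_eq_iff\<close> compares.\<close>
  have "e (gen 1) \<otimes>\<^bsub>RG\<^esub> e (gen 2) \<ominus>\<^bsub>RG\<^esub> (e (gen 2) \<otimes>\<^bsub>RG\<^esub> e (gen 1) \<oplus>\<^bsub>RG\<^esub> lam_elt) = rel"
    by (simp add: rel_def RG.minus_eq RG.minus_add RG.a_assoc)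
  moreover have "rel \<in> I" unfolding I_def by (rule RG.genideal_self') simp
  ultimately have "\<pi> (e (gen 1) \<otimes>\<^bsub>RG\<^esub> e (gen 2)) = \<pi> (e (gen 2) \<otimes>\<^bsub>RG\<^esub> e (gen 1) \<oplus>\<^bsub>RG\<^esub> lam_elt)"
    by (subst \<pi>_eq_iff) auto
  moreover have "\<pi> lam_elt = (\<Oplus>\<^bsub>H\<^esub>t\<in>F. \<pi> (e (scalar (l t))) \<otimes>\<^bsub>H\<^esub> \<pi> (u t))"
  proof -
    have "\<pi> lam_elt = (\<Oplus>\<^bsub>H\<^esub>t\<in>F. \<pi> (e (scalar (l t)) \<otimes>\<^bsub>RG\<^esub> u t))"
    proof -
      have "\<pi> (\<Oplus>\<^bsub>RG\<^esub>t\<in>J. q t) = (\<Oplus>\<^bsub>H\<^esub>t\<in>J. \<pi> (q t))"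
        if "finite J" "\<And>t. t \<in> J \<Longrightarrow> q t \<in> carrier RG" for J and q :: "'k \<Rightarrow> _"
        using that
      proof induction
        case (insert t J)
        then have "q \<in> J \<rightarrow> carrier RG" "(\<lambda>t. \<pi> (q t)) \<in> J \<rightarrow> carrier H" by auto
        then show ?case using insert by (simp add: RG.finsum_insert HR.finsum_insert)
      qed simp
      from this[OF finite_F, of "\<lambda>t. e (scalar (l t)) \<otimes>\<^bsub>RG\<^esub> u t"] show ?thesis
        unfolding lam_elt_eq by simp
    qed
    also have "\<dots> = (\<Oplus>\<^bsub>H\<^esub>t\<in>F. \<pi> (e (scalar (l t))) \<otimes>\<^bsub>H\<^esub> \<pi> (u t))"
      by (intro HR.finsum_cong') auto
    finally show ?thesis .
  qed
  ultimately show "\<pi> (e (gen 1)) \<otimes>\<^bsub>H\<^esub> \<pi> (e (gen 2)) = \<pi> (e (gen 2)) \<otimes>\<^bsub>H\<^esub> \<pi> (e (gen 1))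
      \<oplus>\<^bsub>H\<^esub> (\<Oplus>\<^bsub>H\<^esub>t\<in>F. \<pi> (e (scalar (l t))) \<otimes>\<^bsub>H\<^esub> \<pi> (u t))"
    by simp
qed (auto simp: finite_F)

text \<open>\<Phi> carries the action on the Ore extension to left multiplication, which needs
  checking on generators only. The vector \<open>m\<close> is kept arbitrary because the product
  case uses the hypothesis for \<open>f\<close> at the vector \<open>ap (ext h) m\<close>.\<close>

lemma \<Phi>_ext: "r \<in> carrier RG \<Longrightarrow> ore.\<Phi> (ap (ext r) m) = \<pi> r \<otimes>\<^bsub>H\<^esub> ore.\<Phi> m"
proof (induction r arbitrary: m rule: RG_induct)
  case (scalar c)
  show ?case by (simp add: ext_e ore.\<Phi>_smult[OF ore.\<Phi>A_const_mult])
next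
  case x
  show ?case by (simp add: ext_e ore.\<Phi>_smult[OF ore.\<Phi>A_x_mult])
next
  case y
  show ?case by (simp add: ext_e ore.\<Phi>_Y)
next
  case (u t)
  then show ?case by (simp add: ext_u ore.\<Phi>_smult[OF ore.\<Phi>A_pt_mult])
next
  case (add f h)
  then show ?case by (simp add: ext_add ore.\<Phi>_add HR.l_distr)
next
  case (mult f h)
  then show ?case by (simp add: ext_mult HR.m_assoc)
qed

text \<open>Evaluating at the vector 1 recovers the class of \<open>r\<close>; in particular it is
  zero as soon as \<open>ap (ext r) 1\<close> is.\<close>

lemma \<pi>_eq_\<Phi>: "r \<in> carrier RG \<Longrightarrow> \<pi> r = ore.\<Phi> (ap (ext r) 1)"
  by (simp add: \<Phi>_ext ore.\<Phi>_1)

end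

section \<open>Infinite divisibility and the central element\<close>

lemma poly_power_dvd_all_imp_0:
  fixes f a :: "'a::field poly"
  assumes "degree f > 0" "\<And>n. f ^ n dvd a"
  shows "a = 0"
proof (rule ccontr)
  assume "a \<noteq> 0"
  \<comment> \<open>The power with exponent \<open>degree a + 1\<close> already has larger degree
    than \<open>a\<close>.\<close>
  have "Suc (degree a) * 1 \<le> Suc (degree a) * degree f"
    using assms(1) by (intro mult_le_mono2) simp
  also have "\<dots> = degree (f ^ Suc (degree a))"
    using assms(1) by (intro degree_power_eq[symmetric]) auto
  also have "\<dots> \<le> degree a"
    using assms(2) \<open>a \<noteq> 0\<close> by (rule dvd_imp_degree_le)
  finally show False by simp
qed

text \<open>The Ore extension is free over \<open>k[x]\<close> on the products of a group element
  with a power of \<open>y\<close>, and \<open>single 0 f\<close> multiplies each coordinate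
  \<open>lookup (coeff m i) t\<close> by \<open>f\<close>. This leaves a question about single
  polynomials.\<close>

lemma gr_poly_divisible_imp_0:
  fixes m :: "'k::field gr poly"
  assumes f: "degree f > 0"
    and "\<And>n. \<exists>m'. m = Polynomial.smult (Poly_Mapping.single 0 f ^ n) m'"
  shows "m = 0"
proof (rule poly_eqI, rule poly_mapping_eqI)
  fix i t
  have single_mult: "Poly_Mapping.lookup (Poly_Mapping.single 0 g * a) t = g * Poly_Mapping.lookup a t"
    for g and a :: "'k gr"
    by (induction a rule: poly_mapping_single_induct)
      (auto simp: mult_single lookup_single lookup_add distrib_left when_def)
  have single_pow: "Poly_Mapping.single (0::'k) f ^ n = Poly_Mapping.single 0 (f ^ n)" for n
    by (induction n) (simp_all add: mult_single)
  have "f ^ n dvd Poly_Mapping.lookup (coeff m i) t" for n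
    using assms(2)[of n] by (auto simp: single_pow single_mult)
  then show "Poly_Mapping.lookup (coeff m i) t = Poly_Mapping.lookup (coeff 0 i) t"
    using poly_power_dvd_all_imp_0[OF f] by simp
qed

context H_algebra
begin

definition z where "z = e (gen 1) [^]\<^bsub>RG\<^esub> CHAR('k)"

lemma z_closed [simp, intro]: "z \<in> carrier RG"
  by (simp add: z_def)

text \<open>Generators suffice: scalars are central, \<open>X\<close> and the group commute with
  every polynomial in \<open>X\<close>, and the derivative of \<open>x^p\<close> vanishes. Commuting
  with \<open>y\<close> uses the relation, so this is a statement about the quotient.\<close>

lemma z_central: "h \<in> carrier H \<Longrightarrow> \<pi> z \<otimes>\<^bsub>H\<^esub> h = h \<otimes>\<^bsub>H\<^esub> \<pi> z"
proof -
  have zX: "\<pi> z = \<pi> (e (gen 1)) [^]\<^bsub>H\<^esub> CHAR('k)"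
    by (simp add: z_def \<pi>_pow)
  have z_pol: "\<pi> z = ore.pol (monom 1 CHAR('k))"
    by (simp add: zX ore.pol_monom)
  assume "h \<in> carrier H"
  then obtain r where r: "r \<in> carrier RG" "h = \<pi> r" using \<pi>_surj by blast
  have "\<pi> z \<otimes>\<^bsub>H\<^esub> \<pi> r = \<pi> r \<otimes>\<^bsub>H\<^esub> \<pi> z"
    using r(1)
  proof (induction r rule: RG_induct)
    case (scalar c)
    then show ?case by (simp add: \<pi>_scalar_central)
  next
    case x
    then show ?case unfolding z_pol by (simp add: ore.X_pol)
  next
    case y
    then show ?case unfolding zX by (subst ore.Y_X_pow_char) auto
  next
    case (u t)
    then show ?case unfolding z_pol by (simp add: ore.\<delta>_pol)
  next
    case (add f h)
    then show ?case by (simp add: HR.l_distr HR.r_distr)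
  next
    case (mult f h)
    have "\<pi> z \<otimes>\<^bsub>H\<^esub> (\<pi> f \<otimes>\<^bsub>H\<^esub> \<pi> h) = \<pi> f \<otimes>\<^bsub>H\<^esub> (\<pi> z \<otimes>\<^bsub>H\<^esub> \<pi> h)"
      using mult.hyps mult.IH(1) by (simp flip: HR.m_assoc)
    also have "\<dots> = \<pi> f \<otimes>\<^bsub>H\<^esub> (\<pi> h \<otimes>\<^bsub>H\<^esub> \<pi> z)"
      using mult.IH(2) by simp
    also have "\<dots> = \<pi> f \<otimes>\<^bsub>H\<^esub> \<pi> h \<otimes>\<^bsub>H\<^esub> \<pi> z"
      using mult.hyps by (simp add: HR.m_assoc)
    finally show ?case using mult.hyps by simp
  qed
  then show ?thesis using r by simp
qed

text \<open>When \<open>w\<close> acts as the polynomial \<open>f\<close> in \<open>x\<close>,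
  divisibility of \<open>h\<close> by all powers of \<open>w\<close> passes through
  \<open>ext\<close> to the coefficients of \<open>ap (ext r) 1\<close>, where \<open>r\<close>
  represents \<open>h\<close>. This vector is therefore zero, and \<Phi> maps it to
  \<open>h\<close>.\<close>

lemma H_separated:
  assumes w: "w \<in> carrier RG" "ext w = mul_endo (Poly_Mapping.single 0 f)" and f: "degree f > 0"
    and h: "h \<in> carrier H" and div: "\<And>n::nat. \<exists>h'\<in>carrier H. h = \<pi> w [^]\<^bsub>H\<^esub> n \<otimes>\<^bsub>H\<^esub> h'"
  shows "h = \<zero>\<^bsub>H\<^esub>"
proof -
  obtain r where r: "r \<in> carrier RG" "h = \<pi> r" using \<pi>_surj h by blast
  have "\<exists>m'. ap (ext r) 1 = Polynomial.smult (Poly_Mapping.single 0 f ^ n) m'" for n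
  proof -
    obtain h' where h': "h' \<in> carrier H" "h = \<pi> w [^]\<^bsub>H\<^esub> n \<otimes>\<^bsub>H\<^esub> h'" using div by blast
    obtain s where s: "s \<in> carrier RG" "h' = \<pi> s" using \<pi>_surj h' by blast
    have "\<pi> r = \<pi> (w [^]\<^bsub>RG\<^esub> n \<otimes>\<^bsub>RG\<^esub> s)"
      using r h' s w by (simp add: \<pi>_pow)
    then have "r \<ominus>\<^bsub>RG\<^esub> (w [^]\<^bsub>RG\<^esub> n \<otimes>\<^bsub>RG\<^esub> s) \<in> I"
      by (rule iffD1[OF \<pi>_eq_iff, rotated 2]) (use r s w in auto)
    then have "ext (r \<ominus>\<^bsub>RG\<^esub> (w [^]\<^bsub>RG\<^esub> n \<otimes>\<^bsub>RG\<^esub> s)) = 0"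
      by (rule ext_I)
    then have "ext r = mul_endo (Poly_Mapping.single 0 f ^ n) * ext s"
      using r s w by (simp add: RG.minus_eq ext_add ext_minus ext_mult ext_pow mul_endo_power)
    then show ?thesis by auto
  qed
  then have "ap (ext r) 1 = 0" by (rule gr_poly_divisible_imp_0[OF f])
  then show ?thesis using \<pi>_eq_\<Phi>[OF r(1)] r by simp
qed

text \<open>The elements \<open>z\<close> and \<open>1 - z\<close> act as \<open>x^p\<close> and
  \<open>1 - x^p\<close>, both of degree \<open>p > 0\<close>, so each is separated.\<close>

theorem no_projective_cover:
  assumes "simple_module (H_alg lam) S"
  shows "\<not> projective_cover (H_alg lam) P f S"
proof (rule no_projective_cover_if_central_separated[OF assms, of "\<pi> z"])
  let ?p = "CHAR('k)"
  have gr_x_pow: "gr_x ^ n = Poly_Mapping.single 0 (monom 1 n :: 'k poly)" for n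
    by (induction n) (simp_all add: gr_x_def mult_single monom_Suc monom_0 mult.commute[of "[:0, 1:]"] flip: one_pCons)
  have ext_z: "ext z = mul_endo (Poly_Mapping.single 0 (monom 1 ?p))"
    by (simp add: z_def ext_pow ext_e mul_endo_power gr_x_pow)
  have "ext (\<one>\<^bsub>RG\<^esub> \<ominus>\<^bsub>RG\<^esub> z) = mul_endo (Poly_Mapping.single 0 (1 - monom 1 ?p))"
  proof -
    have "ext (\<one>\<^bsub>RG\<^esub> \<ominus>\<^bsub>RG\<^esub> z) = 1 - ext z"
      by (simp add: RG.minus_eq ext_add ext_minus ext_one)
    also have "\<dots> = mul_endo (Poly_Mapping.single 0 (1 - monom 1 ?p))"
      unfolding ext_z by (rule endo_eqI) (simp add: single_diff smult_diff_left)
    finally show ?thesis .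
  qed
  moreover have "degree (1 - monom 1 ?p :: 'k poly) = ?p"
    unfolding diff_conv_add_uminus
    using char_pos by (subst degree_add_eq_right) (simp_all add: degree_monom_eq)
  ultimately have w: "h = \<zero>\<^bsub>H\<^esub>"
    if "h \<in> carrier H" "\<And>n::nat. \<exists>h'\<in>carrier H. h = \<pi> (\<one>\<^bsub>RG\<^esub> \<ominus>\<^bsub>RG\<^esub> z) [^]\<^bsub>H\<^esub> n \<otimes>\<^bsub>H\<^esub> h'" for h
    using H_separated[of "\<one>\<^bsub>RG\<^esub> \<ominus>\<^bsub>RG\<^esub> z"] char_pos that by simp
  have w_eq: "\<pi> (\<one>\<^bsub>RG\<^esub> \<ominus>\<^bsub>RG\<^esub> z) = \<one>\<^bsub>H\<^esub> \<ominus>\<^bsub>H\<^esub> \<pi> z"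
    by (simp add: RG.minus_eq HR.minus_eq)
  fix w h
  assume "w = \<pi> z \<or> w = \<one>\<^bsub>H_alg lam\<^esub> \<ominus>\<^bsub>H_alg lam\<^esub> \<pi> z" "h \<in> carrier (H_alg lam)"
    "\<And>n::nat. \<exists>h'\<in>carrier (H_alg lam). h = w [^]\<^bsub>H_alg lam\<^esub> n \<otimes>\<^bsub>H_alg lam\<^esub> h'"
  then show "h = \<zero>\<^bsub>H_alg lam\<^esub>"
    unfolding H_alg_eq
    using w[of h] H_separated[OF z_closed ext_z _ , of h] char_pos w_eq by (auto simp: degree_monom_eq)
qed (auto simp: H_alg_eq z_central)

end

theorem corollary5p20:
  fixes p :: nat
    and lam :: "'k::alg_closed_field ^ 2 ^ 2 \<Rightarrow> 'k"
    and S :: "(('k ^ 2 ^ 2 \<Rightarrow> (2, 'k) free_alg) set, 's) module"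
  assumes "prime p" and "odd p" and "CHAR('k) = p"
    and "lam \<in> kG"
    and "simple_module (H_alg lam) S"
  shows "\<not> (\<exists>(P :: (('k ^ 2 ^ 2 \<Rightarrow> (2, 'k) free_alg) set, 'p) module) f.
    projective_cover (H_alg lam) P f S)"
proof -
  interpret H_algebra lam
    using assms by unfold_locales (auto simp: prime_gt_0_nat)
  show ?thesis
    using no_projective_cover[OF assms(5)] by blast
qed

end
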